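(* Let $0<\alpha<n$, let $1<p\le q<\infty$, and let $\sigma,w$ be two weights on $\mathbb{R}^n$. Let $\epsilon_q$ be a positive monotonic increasing function on $[1,\infty)$ satisfying $\int_1^\infty \frac{dt}{t\,\epsilon_q(t)^q}=1$. For a cube $Q$ define $$\beta(Q):=\frac{\sigma(Q)^{1/p'}\,w(Q)^{1/q}}{|Q|^{1-\alpha/n}}\,\rho_\sigma(Q)^{1/p}\,\epsilon_q(\rho_\sigma(Q)),$$ and set $\lceil\sigma,w\rceil:=\sup_{Q}\beta(Q)$, the supremum being over all cubes $Q\subset\mathbb{R}^n$. Then there is a constant $C$, depending only on $n,\alpha,p,q$ and $\epsilon_q$ (not on $f,\sigma,w$), such that for all $f\in L^p(\sigma)$ $$\|M_\alpha(f\sigma)\|_{L^q(w)}\le C\,\lceil\sigma,w\rceil\,\|f\|_{L^p(\sigma)}.$$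
   Context: A weight is a non-negative locally integrable function on $\mathbb{R}^n$. For a weight $\sigma$, $\sigma(Q)=\int_Q\sigma\,dx$, and $L^p(\sigma)$ is the $L^p$ space of the measure $\sigma\,dx$. $|Q|$ is Lebesgue measure; $p'$ is the conjugate exponent of $p$, $1/p+1/p'=1$. The fractional maximal operator is $$M_\alpha f(x):=\sup_{Q\text{ a cube}}\frac{\mathbf 1_Q(x)}{|Q|^{1-\alpha/n}}\int_Q|f(y)|\,dy .$$ $M$ denotes the Hardy–Littlewood maximal operator, $Mf(x)=\sup_{Q\text{ a cube}}\frac{\mathbf 1_Q(x)}{|Q|}\int_Q|f|\,dy$, and $$\rho_\sigma(Q):=\frac{1}{\sigma(Q)}\int_Q M(\sigma\mathbf 1_Q)\,dx ,$$ so $\rho_\sigma(Q)\in[1,\infty]$ when $\sigma(Q)>0$. Conventions: $\beta(Q)=0$ if $\sigma(Q)=0$ or $w(Q)=0$; otherwise $\beta(Q)=\infty$ if $\rho_\sigma(Q)=\infty$. The inequality is regarded as trivially true when $\lceil\sigma,w\rceil=\infty$. *)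

theory Defs
  imports "HOL-Analysis.Analysis"
begin

text \<open>
  Integrals of non-negative functions, suprema and norms take values in \<^typ>\<open>ennreal\<close>, that is
  in $[0,\infty]$. Cubes are closed, non-degenerate, with sides parallel to the coordinate axes.
\<close>

definition cubes :: "(real^'n) set set" where
  "cubes = {cbox a (\<chi> i. a $ i + l) | a l. 0 < l}"

definition weight :: "(real^'n \<Rightarrow> real) \<Rightarrow> bool" where
  "weight \<sigma> \<longleftrightarrow> (\<forall>x. 0 \<le> \<sigma> x) \<and> (\<forall>K. compact K \<longrightarrow> set_integrable lebesgue K \<sigma>)"

text \<open>The measure $\sigma\,dx$; its value on $Q$ is $\sigma(Q)$.\<close>

definition weighted :: "(real^'n \<Rightarrow> real) \<Rightarrow> (real^'n) measure" where
  "weighted \<sigma> = density lebesgue (\<lambda>x. ennreal (\<sigma> x))"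

text \<open>Power of an element of $[0,\infty]$, for exponents \<open>a > 0\<close> only.\<close>

definition ennpow :: "ennreal \<Rightarrow> real \<Rightarrow> ennreal" where
  "ennpow x a = (if x = \<infinity> then \<infinity> else ennreal (enn2real x powr a))"

definition Lp_norm :: "real \<Rightarrow> 'a measure \<Rightarrow> ('a \<Rightarrow> ennreal) \<Rightarrow> ennreal" where
  "Lp_norm p M g = ennpow (\<integral>\<^sup>+x. ennpow (g x) p \<partial>M) (1 / p)"

definition Lp_space :: "real \<Rightarrow> 'a measure \<Rightarrow> ('a \<Rightarrow> real) set" where
  "Lp_space p M = {f \<in> borel_measurable M. Lp_norm p M (\<lambda>x. ennreal \<bar>f x\<bar>) < \<infinity>}"

definition conj_exp :: "real \<Rightarrow> real" where
  "conj_exp p = p / (p - 1)"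

lemma conj_exp: "1 < p \<Longrightarrow> 1 / p + 1 / conj_exp p = 1"
  by (simp add: conj_exp_def field_simps)

definition frac_maximal :: "real \<Rightarrow> (real^'n \<Rightarrow> real) \<Rightarrow> real^'n \<Rightarrow> ennreal" where
  "frac_maximal \<alpha> f x =
    (SUP Q\<in>cubes. indicator Q x / ennreal (measure lebesgue Q powr (1 - \<alpha> / real CARD('n)))
       * (\<integral>\<^sup>+y\<in>Q. ennreal \<bar>f y\<bar> \<partial>lebesgue))"

definition hl_maximal :: "(real^'n \<Rightarrow> real) \<Rightarrow> real^'n \<Rightarrow> ennreal" where
  "hl_maximal f x =
    (SUP Q\<in>cubes. indicator Q x / ennreal (measure lebesgue Q)
       * (\<integral>\<^sup>+y\<in>Q. ennreal \<bar>f y\<bar> \<partial>lebesgue))"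

definition rho :: "(real^'n \<Rightarrow> real) \<Rightarrow> (real^'n) set \<Rightarrow> ennreal" where
  "rho \<sigma> Q =
    (\<integral>\<^sup>+x\<in>Q. hl_maximal (\<lambda>y. \<sigma> y * indicator Q y) x \<partial>lebesgue) / emeasure (weighted \<sigma>) Q"

definition beta ::
  "real \<Rightarrow> real \<Rightarrow> real \<Rightarrow> (real \<Rightarrow> real) \<Rightarrow> (real^'n \<Rightarrow> real) \<Rightarrow> (real^'n \<Rightarrow> real) \<Rightarrow>
    (real^'n) set \<Rightarrow> ennreal" where
  "beta \<alpha> p q \<epsilon> \<sigma> w Q =
    (if emeasure (weighted \<sigma>) Q = 0 \<or> emeasure (weighted w) Q = 0 then 0
     else if rho \<sigma> Q = \<infinity> then \<infinity>
     else ennpow (emeasure (weighted \<sigma>) Q) (1 / conj_exp p) * ennpow (emeasure (weighted w) Q) (1 / q)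
          / ennreal (measure lebesgue Q powr (1 - \<alpha> / real CARD('n)))
          * ennpow (rho \<sigma> Q) (1 / p) * ennreal (\<epsilon> (enn2real (rho \<sigma> Q))))"

definition two_weight ::
  "real \<Rightarrow> real \<Rightarrow> real \<Rightarrow> (real \<Rightarrow> real) \<Rightarrow> (real^'n \<Rightarrow> real) \<Rightarrow> (real^'n \<Rightarrow> real) \<Rightarrow> ennreal" where
  "two_weight \<alpha> p q \<epsilon> \<sigma> w = (SUP Q\<in>cubes. beta \<alpha> p q \<epsilon> \<sigma> w Q)"

end

theory Submission
  imports Defs
begin

text \<open>
  By the one-third trick every cube lies in a comparable cube of one of \<open>2 ^ n\<close> shifted dyadic
  grids, so it suffices to bound the maximal function of a finite part of one grid; Fatou's lemma
  then removes the truncation. Write \<open>a(Q)\<close> for the fractional average of \<open>|f|\<sigma>\<close> over \<open>Q\<close>. The cubes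
  of the family that are maximal at their level \<open>2 ^ k < a(Q) \<le> 2 ^ (k + 1)\<close> control the maximal
  function, and they are sparse because \<open>|R| ^ (\<alpha>/n) \<le> |Q| ^ (\<alpha>/n)\<close> for \<open>R \<subseteq> Q\<close>. Hence the
  \<open>L ^ q(w)\<close> norm to the power \<open>q\<close> is dominated by the sum of \<open>w(Q) a(Q) ^ q\<close> over a sparse family.

  Split this family according to \<open>2 ^ r \<le> \<rho>(Q) < 2 ^ (r + 1)\<close>. In one class, sparseness gives the
  packing bound \<open>\<Sum> \<sigma>(Q) \<le> 4 \<integral> M(\<sigma> 1_R) = 4 \<rho>(R) \<sigma>(R)\<close> over the \<open>Q \<subseteq> R\<close>, so the Carleson embedding
  theorem applies with constant \<open>8 * 2 ^ r\<close>; the factor \<open>\<rho> ^ (1/p)\<close> in the bump condition cancels this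
  constant. What remains is the sum of \<open>\<epsilon>(2 ^ r) ^ (-q)\<close>, which the integral condition bounds.
\<close>

section \<open>Finite laminar families\<close>

text \<open>The obstacle is that a sparse family need not be Carleson with respect to \<sigma>:
  sparseness refers to Lebesgue measure, and the loss in changing to \<sigma> is \<rho>, which is
  unbounded over the cubes. Within one class of \<rho> the loss is uniform, because the packing
  bound is needed only below cubes R of that same class. The factor \<epsilon> then pays for the
  number of classes. The condition p <= q enters once, in passing from a sum of p-th powers to a sum
  of q-th powers through the exponent q/p. All families are finite, so maximal cubes exist and the
  estimates are between real numbers; every constant is independent of the family. The grids are
  shifted by 2^N/3, which varies with the truncation parameter N, so the truncated families do not
  increase with N. This is why the limit is taken by Fatou's lemma and not by monotone
  convergence.\<close>

definition laminar :: "'a set set \<Rightarrow> bool" where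
  "laminar F \<longleftrightarrow> (\<forall>A\<in>F. \<forall>B\<in>F. A \<inter> B = {} \<or> A \<subseteq> B \<or> B \<subseteq> A)"

definition maximal_members :: "'a set set \<Rightarrow> 'a set set" where
  "maximal_members F = {R\<in>F. \<forall>Q\<in>F. R \<subseteq> Q \<longrightarrow> Q = R}"

lemma laminar_subset: "laminar F \<Longrightarrow> G \<subseteq> F \<Longrightarrow> laminar G"
  unfolding laminar_def by blast

lemma maximal_members_subset: "maximal_members F \<subseteq> F"
  unfolding maximal_members_def by blast

lemma disjoint_maximal_members:
  assumes "laminar F" shows "disjoint (maximal_members F)"
proof -
  have "A = B \<or> A \<inter> B = {}" if "A \<in> maximal_members F" "B \<in> maximal_members F" for A B
  proof -
    have "A \<in> F" "B \<in> F" using that maximal_members_def by auto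
    then have "A \<inter> B = {} \<or> A \<subseteq> B \<or> B \<subseteq> A" using assms laminar_def by metis
    moreover have "A \<subseteq> B \<Longrightarrow> A = B" "B \<subseteq> A \<Longrightarrow> A = B"
      using that unfolding maximal_members_def by blast+
    ultimately show ?thesis by metis
  qed
  then show ?thesis unfolding disjoint_def by metis
qed

lemma obtain_maximal_member:
  assumes "finite F" "Q \<in> F"
  obtains R where "R \<in> maximal_members F" "Q \<subseteq> R"
proof -
  obtain R where "R \<in> F" "Q \<subseteq> R" "\<forall>P\<in>F. R \<subseteq> P \<longrightarrow> R = P"
    using finite_has_maximal2[OF assms] by blast
  then show ?thesis using that unfolding maximal_members_def by blast
qed

lemma Union_maximal_members:
  assumes "finite F" shows "\<Union>(maximal_members F) = \<Union>F"
proof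
  show "\<Union>F \<subseteq> \<Union>(maximal_members F)"
  proof
    fix x assume "x \<in> \<Union>F"
    then obtain Q where "Q \<in> F" "x \<in> Q" by blast
    then show "x \<in> \<Union>(maximal_members F)"
      by (meson UnionI assms obtain_maximal_member subsetD)
  qed
qed (use maximal_members_subset in blast)

text \<open>Every Q lies below some maximal member, so c Q is counted at least once on the
  right.\<close>

lemma sum_le_sum_maximal_members:
  fixes c :: "'a set \<Rightarrow> real"
  assumes F: "finite F" and c: "\<And>Q. Q \<in> F \<Longrightarrow> 0 \<le> c Q"
  shows "(\<Sum>Q\<in>F. c Q) \<le> (\<Sum>R\<in>maximal_members F. \<Sum>Q\<in>{Q\<in>F. Q \<subseteq> R}. c Q)"
proof -
  have fm: "finite (maximal_members F)"
    using F maximal_members_subset finite_subset by blast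
  have "(\<Sum>Q\<in>F. c Q) \<le> (\<Sum>Q\<in>F. \<Sum>R\<in>maximal_members F. if Q \<subseteq> R then c Q else 0)"
  proof (rule sum_mono)
    fix Q assume Q: "Q \<in> F"
    obtain R where R: "R \<in> maximal_members F" "Q \<subseteq> R"
      using obtain_maximal_member[OF F Q] by blast
    have "c Q = (if Q \<subseteq> R then c Q else 0)" using R by simp
    also have "\<dots> \<le> (\<Sum>R\<in>maximal_members F. if Q \<subseteq> R then c Q else 0)"
      by (rule member_le_sum[OF R(1) _ fm]) (use c Q in auto)
    finally show "c Q \<le> (\<Sum>R\<in>maximal_members F. if Q \<subseteq> R then c Q else 0)" .
  qed
  also have "\<dots> = (\<Sum>R\<in>maximal_members F. \<Sum>Q\<in>F. if Q \<subseteq> R then c Q else 0)"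
    by (rule sum.swap)
  also have "\<dots> = (\<Sum>R\<in>maximal_members F. \<Sum>Q\<in>{Q\<in>F. Q \<subseteq> R}. c Q)"
    using F by (simp add: sum.inter_filter)
  finally show ?thesis .
qed

lemma sum_set_integral_disjoint_le:
  fixes h :: "'a \<Rightarrow> real"
  assumes "finite D" "disjoint D" "D \<subseteq> sets M" "\<And>R. R \<in> D \<Longrightarrow> R \<subseteq> Q" "Q \<in> sets M"
    and h: "set_integrable M Q h" "\<And>x. 0 \<le> h x"
  shows "(\<Sum>R\<in>D. LINT x:R|M. h x) \<le> (LINT x:Q|M. h x)"
proof -
  have int: "set_integrable M R h" if "R \<in> D" for R
    using set_integrable_subset[OF h(1)] assms that by blast
  have "(\<Sum>R\<in>D. LINT x:R|M. h x) = (LINT x|M. (\<Sum>R\<in>D. indicat_real R x * h x))"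
    using int unfolding set_lebesgue_integral_def set_integrable_def
    by (subst Bochner_Integration.integral_sum) auto
  also have "\<dots> \<le> (LINT x:Q|M. h x)"
    unfolding set_lebesgue_integral_def
  proof (rule integral_mono)
    show "integrable M (\<lambda>x. \<Sum>R\<in>D. indicat_real R x * h x)"
      using int unfolding set_integrable_def by (auto intro!: Bochner_Integration.integrable_sum)
    show "integrable M (\<lambda>x. indicat_real Q x *\<^sub>R h x)"
      using h(1) unfolding set_integrable_def .
    fix x
    show "(\<Sum>R\<in>D. indicat_real R x * h x) \<le> indicat_real Q x *\<^sub>R h x"
    proof (cases "\<exists>R\<in>D. x \<in> R")
      case True
      then obtain R where R: "R \<in> D" "x \<in> R" by blast
      have "indicat_real P x = 0" if "P \<in> D - {R}" for P
        using R that assms(2) unfolding disjoint_def by (auto simp: indicator_def)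
      then have "(\<Sum>P\<in>D. indicat_real P x * h x) = indicat_real R x * h x"
        using R(1) assms(1) by (subst sum.remove[OF assms(1) R(1)]) auto
      then show ?thesis using R assms(4) by (auto simp: indicator_def)
    next
      case False
      then have "(\<Sum>R\<in>D. indicat_real R x * h x) = 0"
        by (intro sum.neutral) (auto simp: indicator_def)
      then show ?thesis using h(2) by (auto simp: indicator_def)
    qed
  qed
  finally show ?thesis .
qed

section \<open>Dyadic levels\<close>

definition dyadic_level :: "real \<Rightarrow> int" where
  "dyadic_level x = \<lceil>log 2 x\<rceil> - 1"

lemma dyadic_level_less: "0 < x \<Longrightarrow> 2 powr dyadic_level x < x"
proof -
  assume x: "0 < x"
  have "real_of_int (dyadic_level x) < log 2 x"
    unfolding dyadic_level_def by linarith
  then show ?thesis using x less_log_iff[of 2 x "dyadic_level x"] by simp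
qed

lemma dyadic_level_ge: "0 < x \<Longrightarrow> x \<le> 2 powr (dyadic_level x + 1)"
proof -
  assume x: "0 < x"
  have "log 2 x \<le> dyadic_level x + 1"
    unfolding dyadic_level_def by simp
  then show ?thesis using x log_le_iff[of 2 x "dyadic_level x + 1"] by simp
qed

text \<open>A geometric series is controlled by its top term: the largest admissible k has 2^(k-1) <
  y, hence 2^(k s) <= 2^s y^s, and lower terms decay with ratio 2^(-s).\<close>

lemma sum_powr_below_level:
  fixes s y :: real
  assumes K: "finite K" and s: "0 < s" and y: "0 \<le> y"
  shows "(\<Sum>k\<in>{k\<in>K. 2 powr (real_of_int k - 1) < y}. 2 powr (k * s))
    \<le> 2 powr s / (1 - 2 powr (-s)) * y powr s"
proof -
  define J where "J = {k\<in>K. 2 powr (real_of_int k - 1) < y}"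
  have fJ: "finite J" using K unfolding J_def by simp
  have r: "0 < 2 powr (-s)" "2 powr (-s) < (1::real)"
    using s powr_less_one[of 2 "-s"] by (auto simp: powr_less_cancel_iff[of 2 "-s" 0, simplified])
  show ?thesis
  proof (cases "J = {}")
    case True
    then show ?thesis using r unfolding J_def[symmetric] by simp
  next
    case False
    define m where "m = Max J"
    have mJ: "m \<in> J" and mmax: "\<And>k. k \<in> J \<Longrightarrow> k \<le> m"
      using fJ False unfolding m_def by auto
    have inj: "inj_on (\<lambda>k. nat (m - k)) J"
    proof (rule inj_onI)
      fix x y assume "x \<in> J" "y \<in> J" "nat (m - x) = nat (m - y)"
      then show "x = y" using mmax[of x] mmax[of y] by linarith
    qed
    have "(\<Sum>k\<in>J. 2 powr (k * s)) = (\<Sum>k\<in>J. 2 powr (m * s) * (2 powr (-s)) ^ nat (m - k))"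
    proof (rule sum.cong[OF refl])
      fix k assume "k \<in> J"
      then have "real (nat (m - k)) = m - k" using mmax by simp
      then have "(2 powr (-s)) ^ nat (m - k) = 2 powr (-s * (m - k))"
        by (metis powr_powr powr_realpow r(1))
      then have "2 powr (m * s) * (2 powr (-s)) ^ nat (m - k) = 2 powr (m * s + -s * (m - k))"
        by (simp only: powr_add)
      also have "m * s + -s * (m - k) = k * s" by (simp add: algebra_simps)
      finally show "2 powr (k * s) = 2 powr (m * s) * (2 powr (-s)) ^ nat (m - k)" by simp
    qed
    also have "\<dots> = 2 powr (m * s) * (\<Sum>i\<in>(\<lambda>k. nat (m - k)) ` J. (2 powr (-s)) ^ i)"
      by (simp add: sum_distrib_left sum.reindex[OF inj])
    also have "\<dots> \<le> 2 powr (m * s) * (\<Sum>i. (2 powr (-s)) ^ i)"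
      using r fJ by (intro mult_left_mono sum_le_suminf) (auto intro!: summable_geometric)
    also have "\<dots> = 2 powr (m * s) / (1 - 2 powr (-s))"
      using r by (subst suminf_geometric) auto
    also have "\<dots> \<le> (2 powr s * y powr s) / (1 - 2 powr (-s))"
    proof (rule divide_right_mono)
      have "2 powr (m * s) = 2 powr s * (2 powr (real_of_int m - 1)) powr s"
        by (simp add: powr_powr powr_add[symmetric] algebra_simps)
      also have "\<dots> \<le> 2 powr s * y powr s"
        using mJ s unfolding J_def by (intro mult_left_mono powr_mono2) auto
      finally show "2 powr (m * s) \<le> 2 powr s * y powr s" .
    qed (use r in auto)
    finally show ?thesis unfolding J_def[symmetric] by simp
  qed
qed

section \<open>Carleson embedding\<close>

text \<open>Follows from g <= 1 + g^p, the constant being integrable over a set of finite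
  measure.\<close>

lemma set_integrable_of_powr:
  fixes g :: "'a \<Rightarrow> real"
  assumes [measurable]: "g \<in> borel_measurable M" and "\<And>x. 0 \<le> g x" and "1 < p"
    and int: "integrable M (\<lambda>x. g x powr p)"
    and Q: "Q \<in> sets M" "emeasure M Q < \<infinity>"
  shows "set_integrable M Q g"
  unfolding set_integrable_def
proof (rule Bochner_Integration.integrable_bound)
  show "integrable M (\<lambda>x. indicat_real Q x + g x powr p)"
    using Q int by (intro Bochner_Integration.integrable_add integrable_real_indicator) auto
  show "(\<lambda>x. indicat_real Q x *\<^sub>R g x) \<in> borel_measurable M"
    using Q by measurable
  show "AE x in M. norm (indicat_real Q x *\<^sub>R g x) \<le> norm (indicat_real Q x + g x powr p)"
  proof (rule AE_I2)
    fix x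
    have "g x \<le> 1 + g x powr p"
    proof (cases "g x \<le> 1")
      case False
      then have "g x powr 1 \<le> g x powr p" using \<open>1 < p\<close> by (intro powr_mono) auto
      then show ?thesis using False by simp
    qed (simp add: add_increasing2)
    then show "norm (indicat_real Q x *\<^sub>R g x) \<le> norm (indicat_real Q x + g x powr p)"
      using assms(2)[of x] by (auto simp: indicator_def)
  qed
qed

text \<open>The part of g with g <= t contributes at most t |R| to the integral, half of the assumed
  lower bound, so the other half comes from {t < g}.\<close>

lemma measure_le_integral_above:
  fixes g :: "'a \<Rightarrow> real"
  assumes [measurable]: "g \<in> borel_measurable M" and g0: "\<And>x. 0 \<le> g x"
    and R: "R \<in> sets M" "emeasure M R < \<infinity>" and int: "set_integrable M R g"
    and t: "0 < t" "2 * t * measure M R \<le> (LINT x:R|M. g x)"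
  shows "t * measure M R \<le> (LINT x:R|M. g x * indicat_real {x. t < g x} x)"
proof -
  have [measurable]: "R \<in> sets M" by fact
  have cint: "set_integrable M R (\<lambda>x. t)"
    using R unfolding set_integrable_def by (simp add: less_top)
  have aint: "set_integrable M R (\<lambda>x. g x * indicat_real {x. t < g x} x)"
    unfolding set_integrable_def
  proof (rule Bochner_Integration.integrable_bound[OF int[unfolded set_integrable_def]])
    show "AE x in M. norm (indicat_real R x *\<^sub>R (g x * indicat_real {x. t < g x} x))
        \<le> norm (indicat_real R x *\<^sub>R g x)"
      by (auto simp: indicator_def)
  qed (measurable)
  have "(LINT x:R|M. g x) \<le> (LINT x:R|M. t + g x * indicat_real {x. t < g x} x)"
    using g0 t by (intro set_integral_mono int set_integral_add cint aint) (auto simp: indicator_def)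
  also have "\<dots> = (LINT x:R|M. t) + (LINT x:R|M. g x * indicat_real {x. t < g x} x)"
    by (rule set_integral_add(2)[OF cint aint])
  also have "(LINT x:R|M. t) = t * measure M R"
    using R by (simp add: set_lebesgue_integral_def mult.commute)
  finally show ?thesis using t by simp
qed

text \<open>The factor 2^(p+1) is lost on each level in \<open>carleson_embedding\<close>; the other
  factor is the constant of \<open>sum_powr_below_level\<close> for s = p - 1.\<close>

definition carleson_const :: "real \<Rightarrow> real" where
  "carleson_const p = 2 powr (p + 1) * (2 powr (p - 1) / (1 - 2 powr (- (p - 1))))"

lemma carleson_const_pos: "1 < p \<Longrightarrow> 0 < carleson_const p"
proof -
  assume "1 < p"
  then have "2 powr (- (p - 1)) < (1::real)"
    using powr_less_one[of 2 "-(p-1)"] powr_less_cancel_iff[of 2 "-(p-1)" 0] by simp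
  then show ?thesis unfolding carleson_const_def
    by (intro mult_pos_pos divide_pos_pos) simp_all
qed

text \<open>A discrete Marcinkiewicz interpolation. On the cubes whose average has level k, the
  Carleson condition reduces the sum of c to the measure of the disjoint maximal cubes; a weak-type
  bound for g truncated at 2^(k-1) controls that measure; summing over k restores the p-th power of
  g.\<close>

lemma carleson_embedding:
  fixes g :: "'a \<Rightarrow> real" and c :: "'a set \<Rightarrow> real"
  assumes F: "finite F" "laminar F" "F \<subseteq> sets M"
    and fin: "\<And>Q. Q \<in> F \<Longrightarrow> emeasure M Q < \<infinity>" and pos: "\<And>Q. Q \<in> F \<Longrightarrow> 0 < measure M Q"
    and c0: "\<And>Q. Q \<in> F \<Longrightarrow> 0 \<le> c Q" and A: "0 \<le> A"
    and carl: "\<And>R. R \<in> F \<Longrightarrow> (\<Sum>Q\<in>{Q\<in>F. Q \<subseteq> R}. c Q) \<le> A * measure M R"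
    and p: "1 < p" and gm[measurable]: "g \<in> borel_measurable M" and g0: "\<And>x. 0 \<le> g x"
    and int: "integrable M (\<lambda>x. g x powr p)"
  shows "(\<Sum>Q\<in>F. c Q * ((LINT x:Q|M. g x) / measure M Q) powr p)
    \<le> carleson_const p * A * (LINT x|M. g x powr p)"
proof -
  define av where "av Q = (LINT x:Q|M. g x) / measure M Q" for Q
  define G where "G = {Q\<in>F. 0 < av Q}"
  define lev where "lev Q = dyadic_level (av Q)" for Q
  define K where "K = lev ` G"
  define Gk where "Gk k = {Q\<in>G. lev Q = k}" for k
  have gint: "set_integrable M Q g" if "Q \<in> F" for Q
    using set_integrable_of_powr[OF gm g0 p int] fin F that by blast
  have av0: "0 \<le> av Q" for Q
    unfolding av_def set_lebesgue_integral_def using g0 by (auto intro!: divide_nonneg_nonneg)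
  have fG: "finite G" "finite K" "\<And>k. finite (Gk k)"
    using F unfolding G_def K_def Gk_def by auto
  \<comment> \<open>The truncation is at half of the level 2^k that the averages exceed, as
    \<open>measure_le_integral_above\<close> requires.\<close>
  define tail where "tail k x = g x * indicat_real {x. 2 powr (real_of_int k - 1) < g x} x" for k x
  have tail0: "0 \<le> tail k x" for k x unfolding tail_def using g0 by simp
  have tail_le: "tail k x \<le> (2 powr (real_of_int k - 1)) powr (1 - p) * g x powr p" for k x
  proof (cases "2 powr (real_of_int k - 1) < g x")
    case True
    have "0 < (2::real) powr (real_of_int k - 1)" by simp
    with True have gp: "0 < g x" by linarith
    \<comment> \<open>The exponent 1 - p is negative, so the lower bound on g x bounds the first
      factor from above.\<close>
    have "g x = g x powr (1 - p) * g x powr p" using gp by (simp add: powr_add[symmetric])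
    also have "\<dots> \<le> (2 powr (real_of_int k - 1)) powr (1 - p) * g x powr p"
      using True p by (intro mult_right_mono powr_mono2') auto
    finally show ?thesis using True unfolding tail_def by simp
  qed (simp add: tail_def)
  have tint: "integrable M (tail k)" for k
  proof -
    have 1: "integrable M (\<lambda>x. (2 powr (real_of_int k - 1)) powr (1 - p) * g x powr p)"
      using int by simp
    have "(\<lambda>x. g x * indicat_real {x. 2 powr (real_of_int k - 1) < g x} x) \<in> borel_measurable M"
      by measurable
    then have 2: "tail k \<in> borel_measurable M" unfolding tail_def .
    have 3: "norm (tail k x) \<le> norm ((2 powr (real_of_int k - 1)) powr (1 - p) * g x powr p)" for x
      using tail_le[of k x] tail0[of k x] by simp
    show ?thesis by (rule Bochner_Integration.integrable_bound[OF 1 2]) (use 3 in simp)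
  qed
  have level: "(\<Sum>Q\<in>Gk k. c Q * av Q powr p)
      \<le> A * 2 powr (p + 1) * (2 powr (k * (p - 1)) * (LINT x|M. tail k x))" for k
  proof -
    have le: "av Q powr p \<le> 2 powr ((k + 1) * p)" if "Q \<in> Gk k" for Q
    proof -
      have "0 < av Q" "lev Q = k" using that unfolding Gk_def G_def by auto
      then have "av Q powr p \<le> (2 powr (k + 1)) powr p"
        using dyadic_level_ge[of "av Q"] p unfolding lev_def by (intro powr_mono2) auto
      then show ?thesis by (simp add: powr_powr)
    qed
    have ms: "maximal_members (Gk k) \<subseteq> F" "maximal_members (Gk k) \<subseteq> Gk k"
      using maximal_members_subset[of "Gk k"] unfolding Gk_def G_def by auto
    have fm: "finite (maximal_members (Gk k))" using ms F(1) finite_subset by blast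
    have small: "2 powr (real_of_int k - 1) * measure M R \<le> (LINT x:R|M. tail k x)"
      if "R \<in> maximal_members (Gk k)" for R
      unfolding tail_def
    proof (rule measure_le_integral_above[OF gm g0])
      have R: "R \<in> F" "0 < av R" "lev R = k" using that ms unfolding Gk_def G_def by auto
      then show "R \<in> sets M" "emeasure M R < \<infinity>" "set_integrable M R g" using F fin gint by auto
      have "2 powr k < av R" using dyadic_level_less[OF R(2)] R(3) unfolding lev_def by simp
      then have "2 powr k * measure M R \<le> (LINT x:R|M. g x)"
        using pos[OF R(1)] unfolding av_def by (simp add: pos_less_divide_eq)
      moreover have "2 * 2 powr (real_of_int k - 1) = 2 powr k"
        by (simp add: powr_diff)
      ultimately show "2 * 2 powr (real_of_int k - 1) * measure M R \<le> (LINT x:R|M. g x)" by simp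
    qed simp
    have tails: "(\<Sum>R\<in>maximal_members (Gk k). LINT x:R|M. tail k x) \<le> (LINT x|M. tail k x)"
    proof -
      have dj: "disjoint (maximal_members (Gk k))"
        by (rule disjoint_maximal_members[OF laminar_subset[OF F(2)]]) (auto simp: Gk_def G_def)
      have si: "set_integrable M (space M) (tail k)"
        unfolding set_integrable_def by (rule integrable_mult_indicator[OF sets.top tint])
      have "(\<Sum>R\<in>maximal_members (Gk k). LINT x:R|M. tail k x) \<le> (LINT x:space M|M. tail k x)"
      proof (rule sum_set_integral_disjoint_le[OF fm dj _ _ sets.top si])
        show "maximal_members (Gk k) \<subseteq> sets M" using ms(1) F(3) by simp
        then show "R \<subseteq> space M" if "R \<in> maximal_members (Gk k)" for R
          using that sets.sets_into_space by auto
      qed (rule tail0)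
      also have "\<dots> = (LINT x|M. tail k x)"
        by (rule set_integral_space[OF tint])
      finally show ?thesis .
    qed
    have "(\<Sum>Q\<in>Gk k. c Q * av Q powr p) \<le> (\<Sum>Q\<in>Gk k. c Q) * 2 powr ((k + 1) * p)"
      unfolding sum_distrib_right using le c0
      by (intro sum_mono mult_left_mono) (auto simp: Gk_def G_def)
    also have "(\<Sum>Q\<in>Gk k. c Q) \<le> (\<Sum>R\<in>maximal_members (Gk k). \<Sum>Q\<in>{Q\<in>Gk k. Q \<subseteq> R}. c Q)"
      using c0 by (intro sum_le_sum_maximal_members fG) (auto simp: Gk_def G_def)
    also have "\<dots> \<le> (\<Sum>R\<in>maximal_members (Gk k). A * measure M R)"
    proof (rule sum_mono)
      fix R assume R: "R \<in> maximal_members (Gk k)"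
      have "(\<Sum>Q\<in>{Q\<in>Gk k. Q \<subseteq> R}. c Q) \<le> (\<Sum>Q\<in>{Q\<in>F. Q \<subseteq> R}. c Q)"
        using c0 F(1) by (intro sum_mono2) (auto simp: Gk_def G_def)
      also have "\<dots> \<le> A * measure M R" using carl R ms by blast
      finally show "(\<Sum>Q\<in>{Q\<in>Gk k. Q \<subseteq> R}. c Q) \<le> A * measure M R" .
    qed
    also have "\<dots> \<le> (\<Sum>R\<in>maximal_members (Gk k). A * (2 powr (1 - real_of_int k) * (LINT x:R|M. tail k x)))"
    proof (intro sum_mono mult_left_mono A)
      fix R assume R: "R \<in> maximal_members (Gk k)"
      have "measure M R = 2 powr (1 - real_of_int k) * (2 powr (real_of_int k - 1) * measure M R)"
        by (simp add: powr_add[symmetric] mult.assoc[symmetric])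
      also have "\<dots> \<le> 2 powr (1 - real_of_int k) * (LINT x:R|M. tail k x)"
        by (intro mult_left_mono small R) simp
      finally show "measure M R \<le> 2 powr (1 - real_of_int k) * (LINT x:R|M. tail k x)" .
    qed
    also have "\<dots> = A * 2 powr (1 - real_of_int k) * (\<Sum>R\<in>maximal_members (Gk k). LINT x:R|M. tail k x)"
      by (simp add: sum_distrib_left mult.assoc)
    also have "\<dots> \<le> A * 2 powr (1 - real_of_int k) * (LINT x|M. tail k x)"
      using tails A by (intro mult_left_mono) auto
    finally have "(\<Sum>Q\<in>Gk k. c Q * av Q powr p)
        \<le> A * 2 powr (1 - real_of_int k) * (LINT x|M. tail k x) * 2 powr ((k + 1) * p)"
      by (simp add: mult_right_mono)
    also have "\<dots> = A * (2 powr (1 - real_of_int k) * 2 powr ((k + 1) * p)) * (LINT x|M. tail k x)"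
      by simp
    also have "2 powr (1 - real_of_int k) * 2 powr ((k + 1) * p) = 2 powr (p + 1) * 2 powr (k * (p - 1))"
      by (simp add: powr_add[symmetric] algebra_simps)
    finally show ?thesis by (simp add: mult.assoc)
  qed
  have "(\<Sum>Q\<in>F. c Q * av Q powr p) = (\<Sum>Q\<in>G. c Q * av Q powr p)"
    using F(1) av0 unfolding G_def by (intro sum.mono_neutral_right) (auto simp: order_less_le)
  also have "\<dots> = (\<Sum>k\<in>K. \<Sum>Q\<in>Gk k. c Q * av Q powr p)"
    unfolding Gk_def by (rule sum.group[symmetric]) (use fG in \<open>auto simp: K_def\<close>)
  also have "\<dots> \<le> (\<Sum>k\<in>K. A * 2 powr (p + 1) * (2 powr (k * (p - 1)) * (LINT x|M. tail k x)))"
    by (intro sum_mono level)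
  also have "\<dots> = A * 2 powr (p + 1) * (LINT x|M. (\<Sum>k\<in>K. 2 powr (k * (p - 1)) * tail k x))"
    using tint by (simp add: sum_distrib_left Bochner_Integration.integral_sum)
  also have "\<dots> \<le> A * 2 powr (p + 1) *
      (LINT x|M. 2 powr (p - 1) / (1 - 2 powr (- (p - 1))) * g x powr p)"
  proof (rule mult_left_mono[OF integral_mono])
    show "integrable M (\<lambda>x. \<Sum>k\<in>K. 2 powr (k * (p - 1)) * tail k x)"
      using tint by (intro Bochner_Integration.integrable_sum) auto
    fix x
    \<comment> \<open>With the sum moved inside the integral, only levels with 2^(k-1) < g x survive
      at x; their geometric sum is of order g^(p-1), and the factor g of the tail completes it to
      g^p.\<close>
    have "(\<Sum>k\<in>K. 2 powr (k * (p - 1)) * tail k x)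
        = g x * (\<Sum>k\<in>{k\<in>K. 2 powr (real_of_int k - 1) < g x}. 2 powr (k * (p - 1)))"
      using fG(2) unfolding tail_def sum_distrib_left
      by (subst sum.inter_filter) (auto intro!: sum.cong simp: indicator_def)
    also have "\<dots> \<le> g x * (2 powr (p - 1) / (1 - 2 powr (- (p - 1))) * g x powr (p - 1))"
      using p g0 by (intro mult_left_mono sum_powr_below_level fG) auto
    also have "\<dots> = 2 powr (p - 1) / (1 - 2 powr (- (p - 1))) * g x powr p"
      using g0[of x] p by (cases "g x = 0") (auto simp: powr_diff)
    finally show "(\<Sum>k\<in>K. 2 powr (k * (p - 1)) * tail k x)
      \<le> 2 powr (p - 1) / (1 - 2 powr (- (p - 1))) * g x powr p" .
  qed (use int A in auto)
  finally show ?thesis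
    unfolding av_def carleson_const_def by (simp add: mult.commute mult.left_commute)
qed

section \<open>Sparse selection\<close>

text \<open>Selected subcubes of Q that lie much higher in level occupy at most half of Q, since
  their averages are at least doubled; E Q is what remains. Here \<theta> stands for
  \<alpha>/n.\<close>

lemma sparse_selection:
  fixes h :: "'a \<Rightarrow> real" and \<theta> :: real and M :: "'a measure"
  defines "a \<equiv> \<lambda>Q. (LINT x:Q|M. h x) / measure M Q powr (1 - \<theta>)"
  assumes F: "finite F" "laminar F" "F \<subseteq> sets M"
    and fin: "\<And>Q. Q \<in> F \<Longrightarrow> emeasure M Q < \<infinity>" and pos: "\<And>Q. Q \<in> F \<Longrightarrow> 0 < measure M Q"
    and int: "\<And>Q. Q \<in> F \<Longrightarrow> set_integrable M Q h" and h0: "\<And>x. 0 \<le> h x" and \<theta>: "0 \<le> \<theta>"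
  obtains S E where "S \<subseteq> F" and "\<And>P. P \<in> S \<Longrightarrow> 0 < a P"
    and "\<And>Q x. Q \<in> F \<Longrightarrow> x \<in> Q \<Longrightarrow> 0 < a Q \<Longrightarrow> \<exists>P\<in>S. x \<in> P \<and> a Q \<le> 2 * a P"
    and "\<And>Q. Q \<in> S \<Longrightarrow> E Q \<in> sets M \<and> E Q \<subseteq> Q \<and> measure M Q \<le> 2 * measure M (E Q)"
    and "\<And>x. card {Q\<in>S. x \<in> E Q} \<le> 2"
proof -
  define lev where "lev Q = dyadic_level (a Q)" for Q
  have lev1: "2 powr lev Q < a Q" if "0 < a Q" for Q
    using that unfolding lev_def by (rule dyadic_level_less)
  have lev2: "a Q \<le> 2 * 2 powr lev Q" if "0 < a Q" for Q
    using dyadic_level_ge[OF that] unfolding lev_def by (simp add: powr_add)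
  \<comment> \<open>Larger cubes of higher level are excluded as well as those of equal level, so
    levels strictly increase along every inward chain of selected cubes.\<close>
  define S where "S = {Q\<in>F. 0 < a Q \<and> (\<forall>R\<in>F. Q \<subset> R \<and> 0 < a R \<longrightarrow> lev R < lev Q)}"
  \<comment> \<open>A gap of one level would give only a R > a Q. Two levels give a R > 2 a Q, which
    makes the removed part at most half of Q; the price is an overlap of two instead of
    disjointness.\<close>
  define D where "D Q = {R\<in>S. R \<subset> Q \<and> lev Q + 2 \<le> lev R}" for Q
  define E where "E Q = Q - \<Union>(D Q)" for Q
  have SF: "S \<subseteq> F" and Spos: "\<And>P. P \<in> S \<Longrightarrow> 0 < a P" unfolding S_def by auto
  have Slev: "lev R < lev Q" if "Q \<in> S" "R \<in> S" "Q \<subset> R" for Q R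
    using that unfolding S_def by auto
  have fS: "finite S" using F(1) SF finite_subset by blast
  have nested: "A \<subseteq> B \<or> B \<subseteq> A" if "A \<in> S" "B \<in> S" "x \<in> A" "x \<in> B" for A B x
  proof -
    have "A \<in> F" "B \<in> F" using that SF by auto
    then have "A \<inter> B = {} \<or> A \<subseteq> B \<or> B \<subseteq> A" using F(2) unfolding laminar_def by metis
    then show ?thesis using that by auto
  qed
  have cover: "\<exists>P\<in>S. x \<in> P \<and> a Q \<le> 2 * a P" if Q: "Q \<in> F" "x \<in> Q" "0 < a Q" for Q x
  proof -
    \<comment> \<open>The witness is a cube through x of the highest level that is maximal among
      those. Any strictly larger cube still contains x, so its level can only be lower and the
      witness is selected.\<close>
    define H where "H = {P\<in>F. x \<in> P \<and> 0 < a P}"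
    have fH: "finite H" "Q \<in> H" using F(1) Q unfolding H_def by auto
    define m where "m = Max (lev ` H)"
    have "m \<in> lev ` H" unfolding m_def using fH by (intro Max_in) auto
    then obtain P' where P': "P' \<in> H" "lev P' = m" by blast
    have mmax: "lev R \<le> m" if "R \<in> H" for R
      unfolding m_def using that fH by simp
    define H' where "H' = {P\<in>H. lev P = m}"
    have "finite H'" "H' \<noteq> {}" using fH P' unfolding H'_def by auto
    then obtain P where P: "P \<in> H'" "\<forall>R\<in>H'. P \<subseteq> R \<longrightarrow> P = R"
      using finite_has_maximal[of H'] by blast
    have PH: "P \<in> H" "lev P = m" using P(1) unfolding H'_def by auto
    have "lev R < lev P" if R: "R \<in> F" "P \<subset> R" "0 < a R" for R
    proof -
      have "R \<in> H" using R PH unfolding H_def by auto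
      moreover have "R \<notin> H'" using P(2) R(2) by blast
      ultimately show ?thesis using mmax[of R] PH unfolding H'_def by force
    qed
    then have "P \<in> S" using PH unfolding S_def H_def by auto
    moreover have "a Q \<le> 2 * a P"
    proof -
      have "a Q \<le> 2 * 2 powr lev Q" using lev2 Q by blast
      also have "\<dots> \<le> 2 * 2 powr lev P" using mmax[OF fH(2)] PH by simp
      also have "\<dots> \<le> 2 * a P" using lev1[of P] Spos[OF \<open>P \<in> S\<close>] by simp
      finally show ?thesis .
    qed
    ultimately show ?thesis using PH unfolding H_def by blast
  qed
  have large: "E Q \<in> sets M \<and> E Q \<subseteq> Q \<and> measure M Q \<le> 2 * measure M (E Q)" if Q: "Q \<in> S" for Q
  proof -
    have QF: "Q \<in> F" "0 < a Q" using Q SF Spos by auto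
    define X where "X = maximal_members (D Q)"
    have DF: "D Q \<subseteq> F" "finite (D Q)" using SF fS unfolding D_def by auto
    have XD: "X \<subseteq> D Q" unfolding X_def by (rule maximal_members_subset)
    have XF: "X \<subseteq> F" "finite X" using XD DF finite_subset by auto
    have UX: "\<Union>(D Q) = \<Union>X" unfolding X_def using Union_maximal_members[OF DF(2)] by simp
    have dX: "disjoint X" unfolding X_def
      by (rule disjoint_maximal_members[OF laminar_subset[OF F(2) DF(1)]])
    \<comment> \<open>Replacing |R|^\<theta> by |Q|^\<theta> gives all R a common factor, so the
      integrals over the disjoint R add up to at most a Q |Q|.\<close>
    have bound: "2 * a Q * measure M R \<le> measure M Q powr \<theta> * (LINT x:R|M. h x)" if R: "R \<in> X" for R
    proof -
      have R': "R \<in> F" "0 < a R" "R \<subset> Q" "lev Q + 2 \<le> lev R"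
        using R XD SF Spos unfolding D_def by auto
      have "2 * a Q \<le> 2 * (2 * 2 powr lev Q)" using lev2[OF QF(2)] by simp
      also have "\<dots> = 2 powr (real_of_int (lev Q) + 2)" by (simp add: powr_add)
      also have "\<dots> \<le> 2 powr lev R" using R'(4) by simp
      also have "\<dots> \<le> a R" using lev1[OF R'(2)] by simp
      finally have "2 * a Q * measure M R \<le> a R * measure M R" by (simp add: mult_right_mono)
      also have "\<dots> = measure M R powr \<theta> * (LINT x:R|M. h x)"
        using pos[OF R'(1)] unfolding a_def by (simp add: powr_diff)
      also have "\<dots> \<le> measure M Q powr \<theta> * (LINT x:R|M. h x)"
      proof (rule mult_right_mono)
        have "measure M R \<le> measure M Q"
          using R' QF F(3) fin[OF QF(1)] by (intro measure_mono_fmeasurable) (auto simp: fmeasurable_def)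
        then show "measure M R powr \<theta> \<le> measure M Q powr \<theta>"
          using \<theta> by (intro powr_mono2) auto
        show "0 \<le> (LINT x:R|M. h x)"
          unfolding set_lebesgue_integral_def using h0 by simp
      qed
      finally show ?thesis .
    qed
    have Xs: "R \<in> sets M" "R \<subseteq> Q" if "R \<in> X" for R
      using that XF(1) F(3) XD unfolding D_def by auto
    have "2 * a Q * (\<Sum>R\<in>X. measure M R) \<le> measure M Q powr \<theta> * (\<Sum>R\<in>X. LINT x:R|M. h x)"
      unfolding sum_distrib_left by (intro sum_mono bound)
    also have "\<dots> \<le> measure M Q powr \<theta> * (LINT x:Q|M. h x)"
      using Xs QF F(3) h0 XF
      by (intro mult_left_mono sum_set_integral_disjoint_le[OF XF(2) dX _ _ _ int[OF QF(1)]]) auto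
    also have "\<dots> = a Q * measure M Q"
      using pos[OF QF(1)] unfolding a_def by (simp add: powr_diff)
    finally have "2 * (\<Sum>R\<in>X. measure M R) \<le> measure M Q"
      using QF(2) by (simp add: mult.commute mult.left_commute)
    moreover have "measure M (\<Union>X) \<le> (\<Sum>R\<in>X. measure M R)"
    proof -
      have "R \<in> fmeasurable M" if "R \<in> X" for R
        using XF F(3) fin that by (auto simp: fmeasurable_def)
      then have "measure M (\<Union>R\<in>X. R) \<le> (\<Sum>R\<in>X. measure M R)"
        using XF(2) measure_UNION_le[of X "\<lambda>R. R" M] by (auto simp: fmeasurable_def)
      then show ?thesis by simp
    qed
    moreover have "measure M (E Q) = measure M Q - measure M (\<Union>X)"
    proof -
      have "\<Union>X \<in> sets M" using Xs XF(2) by (intro sets.finite_Union) auto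
      moreover have "\<Union>X \<subseteq> Q" using Xs by blast
      ultimately show ?thesis
        unfolding E_def UX using QF F(3) fin[OF QF(1)] by (intro measure_Diff) auto
    qed
    moreover have "E Q \<in> sets M"
      unfolding E_def UX using Xs XF(2) QF F(3) by (intro sets.Diff sets.finite_Union) auto
    ultimately show ?thesis unfolding E_def by auto
  qed
  have overlap: "card {Q\<in>S. x \<in> E Q} \<le> 2" for x
  proof (cases "{Q\<in>S. x \<in> E Q} = {}")
    case False
    define T where "T = {Q\<in>S. x \<in> E Q}"
    have fT: "finite T" using fS unfolding T_def by simp
    \<comment> \<open>The cubes of T all contain x and form a chain with smallest member Q0. Any
      other member has a lower level, but not lower by two, since then Q0 would have been removed
      from its E-set. So its level is exactly one less, and strict monotonicity along chains leaves
      room for only one.\<close>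
    obtain Q0 where Q0: "Q0 \<in> T" "\<forall>R\<in>T. R \<subseteq> Q0 \<longrightarrow> Q0 = R"
      using finite_has_minimal[OF fT] False unfolding T_def by blast
    have TS: "Q \<in> S" "x \<in> Q" if "Q \<in> T" for Q
      using that unfolding T_def E_def by auto
    have lev: "lev Q = lev Q0 - 1" if Q: "Q \<in> T - {Q0}" for Q
    proof -
      have "Q \<in> T" "Q \<noteq> Q0" using Q by auto
      then have sub: "Q0 \<subset> Q" using nested[of Q Q0 x] TS Q0 by blast
      then have "lev Q < lev Q0" using Slev TS Q0 \<open>Q \<in> T\<close> by blast
      moreover have "Q0 \<notin> D Q" using \<open>Q \<in> T\<close> TS(2)[OF Q0(1)] unfolding T_def E_def by auto
      then have "\<not> lev Q + 2 \<le> lev Q0" using sub TS(1)[OF Q0(1)] unfolding D_def by auto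
      ultimately show ?thesis by linarith
    qed
    have "Q = R" if "Q \<in> T - {Q0}" "R \<in> T - {Q0}" for Q R
    proof -
      have "lev Q = lev R" using lev that by simp
      moreover have "Q \<subseteq> R \<or> R \<subseteq> Q" using nested[of Q R x] TS that by blast
      ultimately show ?thesis using Slev[of Q R] Slev[of R Q] TS that by (metis DiffD1 psubsetI less_irrefl)
    qed
    then have "card (T - {Q0}) \<le> Suc 0"
      using fT by (subst card_le_Suc0_iff_eq) auto
    then show ?thesis using Q0(1) fT unfolding T_def[symmetric] by (simp add: card_Diff_singleton)
  next
    case True
    then show ?thesis by (simp only: card.empty)
  qed
  show ?thesis by (rule that[OF SF Spos cover large overlap])
qed

text \<open>By monotonicity the interval \<open>[2 ^ (r - 1), 2 ^ r)\<close> contributes at least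
  \<open>\<epsilon>(2 ^ r) ^ (-q) / 2\<close> to the integral.\<close>

lemma sum_dyadic_values_le:
  fixes \<epsilon> :: "real \<Rightarrow> real" and q :: real
  assumes pos: "\<forall>t\<ge>1. 0 < \<epsilon> t" and mono: "mono_on {1..} \<epsilon>" and q: "0 < q"
    and int: "(\<integral>\<^sup>+t\<in>{1..}. ennreal (1 / (t * \<epsilon> t powr q)) \<partial>lborel) = 1"
    and R: "finite R"
  shows "(\<Sum>r\<in>R. \<epsilon> (2 ^ r) powr - q) \<le> \<epsilon> 1 powr - q + 2"
proof -
  \<comment> \<open>Both factors of the integrand are estimated at the right endpoint of
    \<open>J r\<close>.\<close>
  define c where "c r = \<epsilon> (2 ^ r) powr - q / 2 ^ r" for r :: nat
  define J where "J r = {2 ^ (r - 1)..<2 ^ r :: real}" for r :: nat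
  \<comment> \<open>Natural subtraction makes \<open>J 0\<close> the empty interval [1, 1), so r = 0
    is split off and accounts for the term \<open>\<epsilon> 1 powr - q\<close>.\<close>
  define P where "P = R - {0}"
  have c0: "0 \<le> c r" for r unfolding c_def by simp
  have fP: "finite P" using R unfolding P_def by simp
  have disj: "r = s" if "t \<in> J r" "t \<in> J s" "r \<noteq> 0" "s \<noteq> 0" for r s t
  proof (rule ccontr)
    assume "r \<noteq> s"
    moreover have False if "t \<in> J r" "t \<in> J s" "r < s" for r s :: nat
    proof -
      have "(2::real) ^ r \<le> 2 ^ (s - 1)" using that(3) by (intro power_increasing) auto
      moreover have "t < 2 ^ r" "2 ^ (s - 1) \<le> t" using that(1,2) unfolding J_def by auto
      ultimately show False by linarith
    qed
    ultimately show False using that by (meson linorder_neqE_nat)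
  qed
  have ptw: "(\<Sum>r\<in>P. ennreal (c r) * indicator (J r) t)
      \<le> ennreal (1 / (t * \<epsilon> t powr q)) * indicator {1..} t" for t
  proof (cases "\<exists>r\<in>P. t \<in> J r")
    case True
    then obtain r where r: "r \<in> P" "t \<in> J r" by blast
    have "(\<Sum>r\<in>P. ennreal (c r) * indicator (J r) t) = (\<Sum>s\<in>{r}. ennreal (c s) * indicator (J s) t)"
      using fP r disj unfolding P_def by (intro sum.mono_neutral_right) (auto simp: indicator_def)
    also have "\<dots> = ennreal (c r)" using r by simp
    also have "\<dots> \<le> ennreal (1 / (t * \<epsilon> t powr q))"
    proof (rule ennreal_leI)
      have t: "2 ^ (r - 1) \<le> t" "t < 2 ^ r" using r unfolding J_def by auto
      moreover have "(1::real) \<le> 2 ^ (r - 1)" by simp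
      ultimately have t1: "1 \<le> t" by linarith
      have "\<epsilon> t \<le> \<epsilon> (2 ^ r)" using t t1 by (intro mono_onD[OF mono]) auto
      moreover have "0 < \<epsilon> t" using pos t1 by simp
      ultimately have e: "\<epsilon> (2 ^ r) powr - q \<le> \<epsilon> t powr - q" using q by (intro powr_mono2') auto
      have "c r \<le> \<epsilon> t powr - q / t"
        unfolding c_def using e t t1 by (intro frac_le) auto
      then show "c r \<le> 1 / (t * \<epsilon> t powr q)"
        by (simp add: powr_minus field_simps)
    qed
    also have "\<dots> = ennreal (1 / (t * \<epsilon> t powr q)) * indicator {1..} t"
    proof -
      have "(1::real) \<le> 2 ^ (r - 1)" by simp
      moreover have "2 ^ (r - 1) \<le> t" using r unfolding J_def by auto
      ultimately have "1 \<le> t" by linarith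
      then show ?thesis by simp
    qed
    finally show ?thesis .
  next
    case False
    then have "(\<Sum>r\<in>P. ennreal (c r) * indicator (J r) t) = 0"
      by (intro sum.neutral) (auto simp: indicator_def)
    then show ?thesis by simp
  qed
  have "ennreal (\<Sum>r\<in>P. \<epsilon> (2 ^ r) powr - q / 2) = (\<Sum>r\<in>P. ennreal (c r) * emeasure lborel (J r))"
  proof -
    have "ennreal (\<epsilon> (2 ^ r) powr - q / 2) = ennreal (c r) * emeasure lborel (J r)" if "r \<in> P" for r
    proof -
      have "(2::real) ^ r = 2 * 2 ^ (r - 1)"
        using that unfolding P_def by (simp add: power_eq_if)
      then have "emeasure lborel (J r) = ennreal (2 ^ r / 2)" unfolding J_def by simp
      then show ?thesis using c0[of r] unfolding c_def by (simp add: ennreal_mult[symmetric])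
    qed
    then show ?thesis by (simp add: sum_ennreal[symmetric])
  qed
  also have "\<dots> = (\<integral>\<^sup>+t. (\<Sum>r\<in>P. ennreal (c r) * indicator (J r) t) \<partial>lborel)"
    by (subst nn_integral_sum) (auto simp: J_def nn_integral_cmult_indicator)
  also have "\<dots> \<le> 1"
    unfolding int[symmetric] by (intro nn_integral_mono ptw)
  finally have "(\<Sum>r\<in>P. \<epsilon> (2 ^ r) powr - q / 2) \<le> 1" by (simp add: ennreal_le_1)
  then have half: "(\<Sum>r\<in>P. \<epsilon> (2 ^ r) powr - q) \<le> 2" by (simp add: sum_divide_distrib[symmetric])
  have "(\<Sum>r\<in>R. \<epsilon> (2 ^ r) powr - q) \<le> (\<Sum>r\<in>insert 0 P. \<epsilon> (2 ^ r) powr - q)"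
    using fP unfolding P_def by (intro sum_mono2) auto
  also have "\<dots> = \<epsilon> 1 powr - q + (\<Sum>r\<in>P. \<epsilon> (2 ^ r) powr - q)"
    using fP by (subst sum.insert) (auto simp: P_def)
  finally show ?thesis using half by simp
qed

section \<open>Weights and cubes\<close>

lemma ennpow_ennreal: "0 \<le> x \<Longrightarrow> ennpow (ennreal x) a = ennreal (x powr a)"
  unfolding ennpow_def by simp

lemma weight_nonneg: "weight \<sigma> \<Longrightarrow> 0 \<le> \<sigma> x"
  unfolding weight_def by simp

text \<open>A weight is given only by its integrability on compact sets; its restrictions to growing
  balls are measurable and converge to it pointwise.\<close>

lemma weight_measurable:
  fixes \<sigma> :: "real^'n \<Rightarrow> real"
  assumes "weight \<sigma>" shows "\<sigma> \<in> borel_measurable lebesgue"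
proof (rule borel_measurable_LIMSEQ_real)
  show "(\<lambda>x. indicat_real (cball 0 (real i)) x * \<sigma> x) \<in> borel_measurable lebesgue" for i
  proof -
    have "set_integrable lebesgue (cball 0 (real i)) \<sigma>"
      using assms unfolding weight_def by simp
    then show ?thesis unfolding set_integrable_def by (auto dest: borel_measurable_integrable)
  qed
  fix x :: "real^'n"
  have "eventually (\<lambda>i. indicat_real (cball 0 (real i)) x * \<sigma> x = \<sigma> x) sequentially"
    using eventually_ge_at_top[of "nat \<lceil>norm x\<rceil>"]
    by eventually_elim (auto simp: indicator_def)
  then show "(\<lambda>i. indicat_real (cball 0 (real i)) x * \<sigma> x) \<longlonglongrightarrow> \<sigma> x"
    by (rule tendsto_eventually)
qed

lemma sets_weighted [simp]: "sets (weighted \<sigma>) = sets lebesgue"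
  unfolding weighted_def by simp

lemma emeasure_weighted:
  assumes "weight \<sigma>" "Q \<in> sets lebesgue"
  shows "emeasure (weighted \<sigma>) Q = (\<integral>\<^sup>+x\<in>Q. ennreal (\<sigma> x) \<partial>lebesgue)"
  unfolding weighted_def using assms weight_measurable[OF assms(1)]
  by (subst emeasure_density) auto

lemma null_sets_weighted:
  assumes "weight \<sigma>" "N \<in> null_sets lebesgue"
  shows "N \<in> null_sets (weighted \<sigma>)"
proof -
  have "absolutely_continuous lebesgue (weighted \<sigma>)"
    unfolding weighted_def using weight_measurable[OF assms(1)]
    by (intro absolutely_continuousI_density) auto
  then show ?thesis using assms(2) unfolding absolutely_continuous_def by auto
qed

lemma emeasure_weighted_compact:
  assumes "weight \<sigma>" "compact Q"
  shows "emeasure (weighted \<sigma>) Q < \<infinity>"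
proof -
  have Q: "Q \<in> sets lebesgue" using assms(2) by (simp add: compact_imp_closed)
  have "integrable lebesgue (\<lambda>x. indicat_real Q x * \<sigma> x)"
    using assms unfolding weight_def set_integrable_def by simp
  then have "(\<integral>\<^sup>+x. ennreal (indicat_real Q x * \<sigma> x) \<partial>lebesgue) < \<infinity>"
    using weight_nonneg[OF assms(1)] by (auto simp: integrable_iff_bounded)
  also have "(\<integral>\<^sup>+x. ennreal (indicat_real Q x * \<sigma> x) \<partial>lebesgue) = emeasure (weighted \<sigma>) Q"
    unfolding emeasure_weighted[OF assms(1) Q]
    by (intro nn_integral_cong) (auto simp: indicator_def)
  finally show ?thesis .
qed

text \<open>Dyadic cubes must be half-open to be nested or disjoint, while \<open>cubes\<close> are
  closed. The missing boundary is null, so Lebesgue and weighted measures agree on Q and its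
  closure, and \<open>rho\<close> and \<open>beta\<close> are always taken at the closure.\<close>

definition almost_cube :: "(real^'n) set \<Rightarrow> bool" where
  "almost_cube Q \<longleftrightarrow> Q \<in> sets lebesgue \<and> closure Q \<in> cubes \<and> closure Q - Q \<in> null_sets lebesgue"

lemma measure_cube:
  fixes a :: "real^'n"
  assumes "0 \<le> l" shows "measure lebesgue (cbox a (\<chi> i. a $ i + l)) = l ^ CARD('n)"
proof -
  have "cbox a (\<chi> i. a $ i + l) \<noteq> {}" using assms by (simp add: interval_ne_empty_cart)
  then show ?thesis by (simp add: content_cbox_cart)
qed

lemma cubes_compact: "Q \<in> cubes \<Longrightarrow> compact Q"
  unfolding cubes_def by auto

lemma cubes_measure_pos: "(Q :: (real^'n) set) \<in> cubes \<Longrightarrow> 0 < measure lebesgue Q"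
proof -
  assume "Q \<in> cubes"
  then obtain a :: "real^'n" and l :: real where "Q = cbox a (\<chi> i. a $ i + l)" "0 < l"
    unfolding cubes_def by blast
  then show ?thesis using measure_cube[of l a] by simp
qed

lemma almost_cubeD:
  assumes "almost_cube Q"
  shows almost_cube_sets: "Q \<in> sets lebesgue" and closure_almost_cube: "closure Q \<in> cubes"
    and measure_closure: "measure lebesgue (closure Q) = measure lebesgue Q"
    and almost_cube_measure_pos: "0 < measure lebesgue Q"
    and almost_cube_fin: "emeasure lebesgue Q < \<infinity>"
    and emeasure_weighted_closure:
      "weight \<sigma> \<Longrightarrow> emeasure (weighted \<sigma>) (closure Q) = emeasure (weighted \<sigma>) Q"
    and emeasure_weighted_fin: "weight \<sigma> \<Longrightarrow> emeasure (weighted \<sigma>) Q < \<infinity>"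
proof -
  show Q: "Q \<in> sets lebesgue" "closure Q \<in> cubes" using assms unfolding almost_cube_def by auto
  have null: "closure Q - Q \<in> null_sets lebesgue" using assms unfolding almost_cube_def by auto
  have cl: "closure Q = Q \<union> (closure Q - Q)" using closure_subset by blast
  have e: "emeasure lebesgue (closure Q) = emeasure lebesgue Q"
    using emeasure_Un_null_set[OF Q(1) null] cl by simp
  then show m: "measure lebesgue (closure Q) = measure lebesgue Q" unfolding measure_def by simp
  show "0 < measure lebesgue Q" using cubes_measure_pos[OF Q(2)] m by simp
  have "emeasure lebesgue (closure Q) < \<infinity>"
    using lmeasurable_compact[OF cubes_compact[OF Q(2)]] unfolding fmeasurable_def by auto
  then show "emeasure lebesgue Q < \<infinity>" using e by simp
  assume \<sigma>: "weight \<sigma>"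
  show *: "emeasure (weighted \<sigma>) (closure Q) = emeasure (weighted \<sigma>) Q"
    using emeasure_Un_null_set[of Q "weighted \<sigma>" "closure Q - Q"] null_sets_weighted[OF \<sigma> null] Q(1) cl
    by simp
  then show "emeasure (weighted \<sigma>) Q < \<infinity>"
    using emeasure_weighted_compact[OF \<sigma> cubes_compact[OF Q(2)]] by simp
qed

section \<open>Localised maximal function, packing, and the bump condition on one cube\<close>

lemma hl_maximal_ge:
  assumes \<sigma>: "weight \<sigma>" and P: "P \<in> cubes" "P \<subseteq> Q" "x \<in> P"
  shows "emeasure (weighted \<sigma>) P / ennreal (measure lebesgue P)
    \<le> hl_maximal (\<lambda>y. \<sigma> y * indicator Q y) x"
proof -
  have "P \<in> sets lebesgue" using cubes_compact[OF P(1)] by (simp add: compact_imp_closed)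
  then have "emeasure (weighted \<sigma>) P = (\<integral>\<^sup>+y\<in>P. ennreal \<bar>\<sigma> y * indicator Q y\<bar> \<partial>lebesgue)"
    using weight_nonneg[OF \<sigma>] P(2) emeasure_weighted[OF \<sigma>]
    by (auto intro!: nn_integral_cong simp: indicator_def)
  then have "emeasure (weighted \<sigma>) P / ennreal (measure lebesgue P)
      = indicator P x / ennreal (measure lebesgue P) * (\<integral>\<^sup>+y\<in>P. ennreal \<bar>\<sigma> y * indicator Q y\<bar> \<partial>lebesgue)"
    using P(3) by (simp add: divide_ennreal_def mult.commute)
  also have "\<dots> \<le> hl_maximal (\<lambda>y. \<sigma> y * indicator Q y) x"
    unfolding hl_maximal_def by (rule SUP_upper[OF P(1)])
  finally show ?thesis .
qed

lemma rho_times: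
  assumes "emeasure (weighted \<sigma>) Q \<noteq> 0" "emeasure (weighted \<sigma>) Q < \<infinity>"
  shows "rho \<sigma> Q * emeasure (weighted \<sigma>) Q
    = (\<integral>\<^sup>+x\<in>Q. hl_maximal (\<lambda>y. \<sigma> y * indicator Q y) x \<partial>lebesgue)"
  unfolding rho_def using assms by (simp add: ennreal_divide_times less_top)

text \<open>On Q the cube Q itself competes in the supremum, so the maximal function is at least
  \<sigma>(Q)/|Q| there; integrate over Q. The bound keeps \<rho> in the domain where \<epsilon> is
  controlled and makes its dyadic class a natural number.\<close>

lemma rho_ge_1:
  assumes \<sigma>: "weight \<sigma>" and Q: "Q \<in> cubes" and pos: "emeasure (weighted \<sigma>) Q \<noteq> 0"
  shows "1 \<le> rho \<sigma> Q"
proof -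
  let ?s = "emeasure (weighted \<sigma>) Q" and ?m = "measure lebesgue Q"
  have fin: "?s < \<infinity>" using emeasure_weighted_compact[OF \<sigma> cubes_compact[OF Q]] .
  have m: "0 < ?m" using cubes_measure_pos[OF Q] .
  have QL: "Q \<in> sets lebesgue" using cubes_compact[OF Q] by (simp add: compact_imp_closed)
  have em: "emeasure lebesgue Q = ennreal ?m"
    by (rule emeasure_eq_measure2[OF lmeasurable_compact[OF cubes_compact[OF Q]]])
  have "?s = ?s / ennreal ?m * emeasure lebesgue Q"
    unfolding em using m by (simp add: ennreal_divide_times)
  also have "\<dots> = (\<integral>\<^sup>+x. ?s / ennreal ?m * indicator Q x \<partial>lebesgue)"
    using QL by (simp add: nn_integral_cmult_indicator)
  also have "\<dots> \<le> (\<integral>\<^sup>+x\<in>Q. hl_maximal (\<lambda>y. \<sigma> y * indicator Q y) x \<partial>lebesgue)"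
    using hl_maximal_ge[OF \<sigma> Q subset_refl]
    by (intro nn_integral_mono) (auto simp: indicator_def)
  finally show ?thesis
    unfolding rho_def using pos fin
    by (metis divide_right_mono_ennreal ennreal_divide_self infinity_ennreal_def less_top)
qed

text \<open>At most two of the sets \<open>E Q\<close> meet at a point, and there each \<open>\<sigma>(Q) / |Q|\<close> is at most \<open>M(\<sigma> 1_R)\<close>.\<close>

lemma sparse_packing:
  fixes \<sigma> :: "real^'n \<Rightarrow> real"
  assumes \<sigma>: "weight \<sigma>" and T: "finite T" "\<And>Q. Q \<in> T \<Longrightarrow> almost_cube Q \<and> Q \<subseteq> R"
    and E: "\<And>Q. Q \<in> T \<Longrightarrow> E Q \<in> sets lebesgue \<and> E Q \<subseteq> Q \<and> measure lebesgue Q \<le> 2 * measure lebesgue (E Q)"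
    and overlap: "\<And>x. card {Q\<in>T. x \<in> E Q} \<le> 2"
    and R: "almost_cube R" "emeasure (weighted \<sigma>) R \<noteq> 0" and \<rho>: "rho \<sigma> (closure R) < \<infinity>"
  shows "(\<Sum>Q\<in>T. measure (weighted \<sigma>) Q)
    \<le> 4 * enn2real (rho \<sigma> (closure R)) * measure (weighted \<sigma>) R"
proof -
  define c where "c Q = measure (weighted \<sigma>) Q / measure lebesgue Q" for Q
  define H where "H = hl_maximal (\<lambda>y. \<sigma> y * indicator (closure R) y)"
  have c0: "0 \<le> c Q" for Q unfolding c_def by simp
  have cH: "ennreal (c Q) \<le> H x" if "Q \<in> T" "x \<in> Q" for Q x
  proof -
    have Q: "almost_cube Q" "Q \<subseteq> R" using T that by auto
    have "emeasure (weighted \<sigma>) (closure Q) / ennreal (measure lebesgue (closure Q)) \<le> H x"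
      unfolding H_def using Q that closure_subset
      by (intro hl_maximal_ge[OF \<sigma> closure_almost_cube]) (auto simp: closure_mono)
    moreover have "emeasure (weighted \<sigma>) (closure Q) = ennreal (measure (weighted \<sigma>) Q)"
      using emeasure_weighted_closure[OF Q(1) \<sigma>] emeasure_weighted_fin[OF Q(1) \<sigma>]
      by (simp add: emeasure_eq_ennreal_measure)
    ultimately show ?thesis
      unfolding c_def using measure_closure[OF Q(1)] almost_cube_measure_pos[OF Q(1)]
      by (simp add: divide_ennreal)
  qed
  have ptw: "(\<Sum>Q\<in>T. ennreal (c Q / 2) * indicator (E Q) x) \<le> H x * indicator (closure R) x" for x
  proof (cases "{Q\<in>T. x \<in> E Q} = {}")
    case True
    then have "(\<Sum>Q\<in>T. ennreal (c Q / 2) * indicator (E Q) x) = 0"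
      by (intro sum.neutral) (auto simp: indicator_def)
    then show ?thesis by simp
  next
    case False
    then obtain Q where "Q \<in> T" "x \<in> E Q" by blast
    then have "x \<in> closure R" using T E closure_subset by blast
    have "(\<Sum>Q\<in>T. ennreal (c Q / 2) * indicator (E Q) x) = (\<Sum>Q\<in>{Q\<in>T. x \<in> E Q}. ennreal (c Q / 2))"
      using T(1) by (intro sum.mono_neutral_cong_right) (auto simp: indicator_def)
    also have "\<dots> \<le> of_nat (card {Q\<in>T. x \<in> E Q}) * (H x / 2)"
    proof (rule sum_bounded_above)
      fix Q assume Q: "Q \<in> {Q\<in>T. x \<in> E Q}"
      have "ennreal (c Q / 2) = ennreal (c Q) / 2"
        using c0[of Q] by (metis divide_ennreal ennreal_numeral zero_le_numeral zero_less_numeral)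
      also have "\<dots> \<le> H x / 2"
        using Q E by (intro divide_right_mono_ennreal cH) auto
      finally show "ennreal (c Q / 2) \<le> H x / 2" .
    qed
    also have "\<dots> \<le> 2 * (H x / 2)"
      using overlap[of x] by (intro mult_right_mono) (metis of_nat_le_iff of_nat_numeral, simp)
    also have "\<dots> = H x"
      by (simp add: ennreal_times_divide mult.commute ennreal_mult_divide_eq)
    finally show ?thesis using \<open>x \<in> closure R\<close> by simp
  qed
  have fin: "emeasure lebesgue (E Q) = ennreal (measure lebesgue (E Q))" if "Q \<in> T" for Q
  proof -
    have "emeasure lebesgue (E Q) \<le> emeasure lebesgue Q"
      using E[OF that] almost_cube_sets[of Q] T(2)[OF that] by (intro emeasure_mono) auto
    also have "\<dots> < \<infinity>" using almost_cube_fin T that by blast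
    finally show ?thesis by (simp add: emeasure_eq_ennreal_measure)
  qed
  have "ennreal (\<Sum>Q\<in>T. c Q / 2 * measure lebesgue (E Q))
      = (\<Sum>Q\<in>T. ennreal (c Q / 2) * emeasure lebesgue (E Q))"
  proof -
    have "ennreal (c Q / 2 * measure lebesgue (E Q)) = ennreal (c Q / 2) * emeasure lebesgue (E Q)"
      if "Q \<in> T" for Q
      unfolding fin[OF that] using c0[of Q] by (intro ennreal_mult) auto
    then show ?thesis using c0 by (subst sum_ennreal[symmetric]) auto
  qed
  also have "\<dots> = (\<integral>\<^sup>+x. (\<Sum>Q\<in>T. ennreal (c Q / 2) * indicator (E Q) x) \<partial>lebesgue)"
  proof (subst nn_integral_sum)
    fix Q assume "Q \<in> T"
    then have [measurable]: "E Q \<in> sets lebesgue" using E by blast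
    show "(\<lambda>x. ennreal (c Q / 2) * indicator (E Q) x) \<in> borel_measurable lebesgue"
      by measurable
  qed (use E in \<open>simp add: nn_integral_cmult_indicator\<close>)
  also have "\<dots> \<le> (\<integral>\<^sup>+x\<in>closure R. H x \<partial>lebesgue)"
    by (intro nn_integral_mono ptw)
  also have "\<dots> = rho \<sigma> (closure R) * emeasure (weighted \<sigma>) (closure R)"
    unfolding H_def using emeasure_weighted_closure[OF R(1) \<sigma>] emeasure_weighted_fin[OF R(1) \<sigma>] R(2)
    by (intro rho_times[symmetric]) auto
  also have "\<dots> = ennreal (enn2real (rho \<sigma> (closure R)) * measure (weighted \<sigma>) R)"
    using emeasure_weighted_closure[OF R(1) \<sigma>] emeasure_weighted_fin[OF R(1) \<sigma>] \<rho>
    by (simp add: ennreal_mult emeasure_eq_ennreal_measure)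
  finally have *: "(\<Sum>Q\<in>T. c Q / 2 * measure lebesgue (E Q))
      \<le> enn2real (rho \<sigma> (closure R)) * measure (weighted \<sigma>) R"
    by (simp add: ennreal_le_iff)
  \<comment> \<open>The constant 4 combines |Q| <= 2 |E Q| with the 2 by which c was divided to
    absorb the overlap.\<close>
  have "(\<Sum>Q\<in>T. measure (weighted \<sigma>) Q) \<le> (\<Sum>Q\<in>T. 4 * (c Q / 2 * measure lebesgue (E Q)))"
  proof (rule sum_mono)
    fix Q assume Q: "Q \<in> T"
    have "measure (weighted \<sigma>) Q = c Q * measure lebesgue Q"
      unfolding c_def using almost_cube_measure_pos T Q by (metis less_irrefl nonzero_eq_divide_eq)
    also have "\<dots> \<le> c Q * (2 * measure lebesgue (E Q))" using E Q c0 by (intro mult_left_mono) auto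
    finally show "measure (weighted \<sigma>) Q \<le> 4 * (c Q / 2 * measure lebesgue (E Q))" by simp
  qed
  also have "\<dots> = 4 * (\<Sum>Q\<in>T. c Q / 2 * measure lebesgue (E Q))" by (simp add: sum_distrib_left)
  finally show ?thesis using * by simp
qed

text \<open>The supremum bound at the closed cube, turned into an inequality between reals. An
  infinite \<rho> would make \<open>beta\<close> infinite by convention, against the finiteness of
  \<open>two_weight\<close>.\<close>

lemma two_weight_bound:
  fixes \<sigma> w :: "real^'n \<Rightarrow> real"
  assumes \<sigma>: "weight \<sigma>" and w: "weight w" and Q: "almost_cube Q"
    and fin: "two_weight \<alpha> p q \<epsilon> \<sigma> w < \<infinity>" and pos: "\<forall>t\<ge>1. 0 < \<epsilon> t"
    and s: "0 < measure (weighted \<sigma>) Q" and \<omega>: "0 < measure (weighted w) Q"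
  shows "rho \<sigma> (closure Q) < \<infinity>" and "1 \<le> enn2real (rho \<sigma> (closure Q))"
    and "measure (weighted \<sigma>) Q powr (1 / conj_exp p) * measure (weighted w) Q powr (1 / q)
        / measure lebesgue Q powr (1 - \<alpha> / real CARD('n))
        * enn2real (rho \<sigma> (closure Q)) powr (1 / p) * \<epsilon> (enn2real (rho \<sigma> (closure Q)))
      \<le> enn2real (two_weight \<alpha> p q \<epsilon> \<sigma> w)"
proof -
  let ?C = "closure Q"
  have es: "emeasure (weighted \<sigma>) ?C = ennreal (measure (weighted \<sigma>) Q)"
    using emeasure_weighted_closure[OF Q \<sigma>] emeasure_weighted_fin[OF Q \<sigma>]
    by (simp add: emeasure_eq_ennreal_measure)
  have ew: "emeasure (weighted w) ?C = ennreal (measure (weighted w) Q)"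
    using emeasure_weighted_closure[OF Q w] emeasure_weighted_fin[OF Q w]
    by (simp add: emeasure_eq_ennreal_measure)
  have le: "beta \<alpha> p q \<epsilon> \<sigma> w ?C \<le> two_weight \<alpha> p q \<epsilon> \<sigma> w"
    unfolding two_weight_def by (rule SUP_upper[OF closure_almost_cube[OF Q]])
  have ne: "\<not> (emeasure (weighted \<sigma>) ?C = 0 \<or> emeasure (weighted w) ?C = 0)"
    using s \<omega> unfolding es ew by simp
  show \<rho>: "rho \<sigma> ?C < \<infinity>"
  proof (rule ccontr)
    assume "\<not> rho \<sigma> ?C < \<infinity>"
    then have "beta \<alpha> p q \<epsilon> \<sigma> w ?C = \<infinity>"
      unfolding beta_def using ne by (simp add: less_top)
    then show False using le fin by simp
  qed
  define r where "r = enn2real (rho \<sigma> ?C)"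
  have er: "rho \<sigma> ?C = ennreal r" unfolding r_def using \<rho> by simp
  have r0: "0 \<le> r" unfolding r_def by simp
  show r1: "1 \<le> enn2real (rho \<sigma> ?C)"
    using rho_ge_1[OF \<sigma> closure_almost_cube[OF Q]] ne r0 unfolding r_def[symmetric] er
    by (simp add: ennreal_ge_1)
  have L: "0 < measure lebesgue Q powr (1 - \<alpha> / real CARD('n))"
    using almost_cube_measure_pos[OF Q] by simp
  have e: "0 < \<epsilon> r" using pos r1 unfolding r_def by simp
  have rinf: "rho \<sigma> ?C \<noteq> \<infinity>" using \<rho> by simp
  have "beta \<alpha> p q \<epsilon> \<sigma> w ?C = ennpow (emeasure (weighted \<sigma>) ?C) (1 / conj_exp p)
        * ennpow (emeasure (weighted w) ?C) (1 / q)
        / ennreal (measure lebesgue ?C powr (1 - \<alpha> / real CARD('n)))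
        * ennpow (rho \<sigma> ?C) (1 / p) * ennreal (\<epsilon> (enn2real (rho \<sigma> ?C)))"
    unfolding beta_def using ne rinf by (simp only: if_False)
  also have "\<dots> = ennreal (measure (weighted \<sigma>) Q powr (1 / conj_exp p) * measure (weighted w) Q powr (1 / q)
        / measure lebesgue Q powr (1 - \<alpha> / real CARD('n)) * r powr (1 / p) * \<epsilon> r)"
    unfolding es ew er measure_closure[OF Q] using L e r0
    by (simp add: ennpow_ennreal divide_ennreal ennreal_mult[symmetric])
  finally have "ennreal (measure (weighted \<sigma>) Q powr (1 / conj_exp p) * measure (weighted w) Q powr (1 / q)
        / measure lebesgue Q powr (1 - \<alpha> / real CARD('n)) * r powr (1 / p) * \<epsilon> r)
      \<le> ennreal (enn2real (two_weight \<alpha> p q \<epsilon> \<sigma> w))"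
    using le fin by simp
  then show "measure (weighted \<sigma>) Q powr (1 / conj_exp p) * measure (weighted w) Q powr (1 / q)
        / measure lebesgue Q powr (1 - \<alpha> / real CARD('n))
        * enn2real (rho \<sigma> ?C) powr (1 / p) * \<epsilon> (enn2real (rho \<sigma> ?C))
      \<le> enn2real (two_weight \<alpha> p q \<epsilon> \<sigma> w)"
    unfolding r_def[symmetric] by (simp add: ennreal_le_iff)
qed

section \<open>The estimate for a finite dyadic family\<close>

text \<open>Each y i is at most the total Y, hence (y i)^t <= y i * Y^(t-1). It is applied with t =
  q/p, where p <= q gives t >= 1.\<close>

lemma sum_powr_le_powr_sum:
  fixes y :: "'a \<Rightarrow> real"
  assumes "finite A" "\<And>i. i \<in> A \<Longrightarrow> 0 \<le> y i" "1 \<le> t"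
  shows "(\<Sum>i\<in>A. y i powr t) \<le> (\<Sum>i\<in>A. y i) powr t"
proof -
  define Y where "Y = (\<Sum>i\<in>A. y i)"
  have Y0: "0 \<le> Y" unfolding Y_def using assms by (intro sum_nonneg)
  have split: "z powr t = z * z powr (t - 1)" if "0 \<le> z" for z
    using that by (cases "z = 0") (auto simp: powr_diff)
  have "(\<Sum>i\<in>A. y i powr t) \<le> (\<Sum>i\<in>A. y i * Y powr (t - 1))"
  proof (rule sum_mono)
    fix i assume i: "i \<in> A"
    have "y i \<le> Y" unfolding Y_def using assms i by (intro member_le_sum) auto
    then have "y i powr (t - 1) \<le> Y powr (t - 1)" using assms i by (intro powr_mono2) auto
    then show "y i powr t \<le> y i * Y powr (t - 1)"
      using split[of "y i"] assms(2)[OF i] by (simp add: mult_left_mono)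
  qed
  also have "\<dots> = Y powr t" using split[OF Y0] unfolding Y_def by (simp add: sum_distrib_right)
  finally show ?thesis unfolding Y_def .
qed

text \<open>To be read with s = \<sigma>(Q), \<omega> = w(Q), L = |Q|^(1-\<alpha>/n), A the integral
  of g \<sigma> over Q, b the two-weight constant, e = \<epsilon>(2^r) and e' = \<epsilon>(\<rho>).
  Since s = s^(1/p') s^(1/p), the q-th root of the left side is the bump quantity times s^(1/p)
  (A/s) / (e 2^(r/p)), where A/s is the \<sigma>-average of g.\<close>

lemma bump_term_bound:
  fixes s \<omega> L \<rho> A b e e' :: real and r :: nat
  assumes p: "1 < p" and q: "0 < q" and pos: "0 < s" "0 < \<omega>" "0 < L" "0 < e" "0 \<le> A" "0 \<le> b"
    and e: "e \<le> e'" and r: "2 ^ r \<le> \<rho>"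
    and b: "s powr (1 / conj_exp p) * \<omega> powr (1 / q) / L * \<rho> powr (1 / p) * e' \<le> b"
  shows "\<omega> * (A / L) powr q
    \<le> b powr q * e powr - q * ((s * (A / s) powr p) / 2 ^ r) powr (q / p)"
proof -
  have c: "1 / conj_exp p = 1 - 1 / p" using p by (simp add: conj_exp_def field_simps)
  have r0: "(0::real) < 2 ^ r" by simp
  \<comment> \<open>The bump is weakened from \<rho> to 2^r, so that the resulting factor depends
    only on the class.\<close>
  have "s powr (1 - 1 / p) * \<omega> powr (1 / q) / L * (2 ^ r) powr (1 / p) * e
      \<le> s powr (1 - 1 / p) * \<omega> powr (1 / q) / L * \<rho> powr (1 / p) * e'"
    using pos p r r0 e by (intro mult_mono mult_left_mono powr_mono2) auto
  also have "\<dots> \<le> b" using b unfolding c .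
  finally have b': "s powr (1 - 1 / p) * \<omega> powr (1 / q) / L * (2 ^ r) powr (1 / p) * e \<le> b" .
  have s1: "s powr (1 - 1 / p) * s powr (1 / p) = s" using pos by (simp add: powr_add[symmetric])
  have "\<omega> powr (1 / q) * (A / L)
      = (s powr (1 - 1 / p) * \<omega> powr (1 / q) / L * (2 ^ r) powr (1 / p) * e)
        * (s powr (1 / p) * (A / s) / (e * (2 ^ r) powr (1 / p)))"
    using pos s1 by (simp add: field_simps)
  also have "\<dots> \<le> b * (s powr (1 / p) * (A / s) / (e * (2 ^ r) powr (1 / p)))"
    using pos b' by (intro mult_right_mono) auto
  finally have "(\<omega> powr (1 / q) * (A / L)) powr q
      \<le> (b * (s powr (1 / p) * (A / s) / (e * (2 ^ r) powr (1 / p)))) powr q"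
    using pos q by (intro powr_mono2) auto
  moreover have "(\<omega> powr (1 / q) * (A / L)) powr q = \<omega> * (A / L) powr q"
    using pos q by (subst powr_mult) (simp_all add: powr_powr)
  moreover have "(b * (s powr (1 / p) * (A / s) / (e * (2 ^ r) powr (1 / p)))) powr q
      = b powr q * e powr - q * ((s * (A / s) powr p) / 2 ^ r) powr (q / p)"
  proof -
    have "s powr (1 / p) * (A / s) / (e * (2 ^ r) powr (1 / p))
        = ((s * (A / s) powr p) / 2 ^ r) powr (1 / p) / e"
      using pos p by (simp add: powr_divide powr_mult powr_powr)
    then have "(b * (s powr (1 / p) * (A / s) / (e * (2 ^ r) powr (1 / p)))) powr q
        = b powr q * (((s * (A / s) powr p) / 2 ^ r) powr (1 / p)) powr q / e powr q"
      using pos by (simp add: powr_mult powr_divide)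
    then show ?thesis
      using pos q by (simp add: powr_powr powr_minus divide_inverse mult_ac)
  qed
  ultimately show ?thesis by simp
qed

lemma integrable_weighted_iff:
  fixes g :: "real^'n \<Rightarrow> real"
  assumes "weight \<sigma>" "g \<in> borel_measurable lebesgue"
  shows "integrable (weighted \<sigma>) g \<longleftrightarrow> integrable lebesgue (\<lambda>x. \<sigma> x * g x)"
  unfolding weighted_def using assms weight_measurable weight_nonneg
  by (intro integrable_real_density) auto

lemma set_integral_weighted:
  fixes g :: "real^'n \<Rightarrow> real"
  assumes "weight \<sigma>" "g \<in> borel_measurable lebesgue" "Q \<in> sets lebesgue"
  shows "(LINT x:Q|weighted \<sigma>. g x) = (LINT x:Q|lebesgue. \<sigma> x * g x)"
proof -
  have "(LINT x:Q|weighted \<sigma>. g x) = (LINT x|lebesgue. \<sigma> x * (indicat_real Q x * g x))"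
    unfolding weighted_def set_lebesgue_integral_def real_scaleR_def
    using assms weight_measurable weight_nonneg by (intro integral_real_density) auto
  then show ?thesis unfolding set_lebesgue_integral_def by (simp add: mult.left_commute)
qed

text \<open>The first factor comes from the Carleson embedding in one class, the second from summing
  over the classes.\<close>

definition bump_const :: "real \<Rightarrow> real \<Rightarrow> (real \<Rightarrow> real) \<Rightarrow> real" where
  "bump_const p q \<epsilon> = (8 * carleson_const p) powr (q / p) * (\<epsilon> 1 powr - q + 2)"

text \<open>The covering property is exported together with the sum bound: it lets the cubes of S
  dominate the maximal function of the whole family. The constant does not involve F, so the
  truncation can be removed later.\<close>

lemma finite_dyadic_estimate:
  fixes \<alpha> p q :: real and \<epsilon> :: "real \<Rightarrow> real" and \<sigma> w g :: "real^'n \<Rightarrow> real" and F :: "(real^'n) set set"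
  defines "a \<equiv> \<lambda>Q. (LINT x:Q|lebesgue. \<sigma> x * g x) / measure lebesgue Q powr (1 - \<alpha> / real CARD('n))"
  assumes \<alpha>: "0 < \<alpha>" and p: "1 < p" and pq: "p \<le> q"
    and pos: "\<forall>t\<ge>1. 0 < \<epsilon> t" and mono: "mono_on {1..} \<epsilon>"
    and int: "(\<integral>\<^sup>+t\<in>{1..}. ennreal (1 / (t * \<epsilon> t powr q)) \<partial>lborel) = 1"
    and \<sigma>: "weight \<sigma>" and w: "weight w" and fin: "two_weight \<alpha> p q \<epsilon> \<sigma> w < \<infinity>"
    and gm: "g \<in> borel_measurable lebesgue" and g0: "\<And>x. 0 \<le> g x"
    and gint: "integrable (weighted \<sigma>) (\<lambda>x. g x powr p)"
    and F: "finite F" "laminar F" "\<And>Q. Q \<in> F \<Longrightarrow> almost_cube Q"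
  obtains S where "S \<subseteq> F"
    and "\<And>Q x. Q \<in> F \<Longrightarrow> x \<in> Q \<Longrightarrow> 0 < a Q \<Longrightarrow> \<exists>P\<in>S. x \<in> P \<and> a Q \<le> 2 * a P"
    and "(\<Sum>P\<in>S. measure (weighted w) P * a P powr q)
      \<le> bump_const p q \<epsilon> * enn2real (two_weight \<alpha> p q \<epsilon> \<sigma> w) powr q
        * (LINT x|weighted \<sigma>. g x powr p) powr (q / p)"
proof -
  define X where "X = (LINT x|weighted \<sigma>. g x powr p)"
  define b where "b = enn2real (two_weight \<alpha> p q \<epsilon> \<sigma> w)"
  define av where "av Q = (LINT x:Q|weighted \<sigma>. g x)" for Q
  define \<rho> where "\<rho> Q = enn2real (rho \<sigma> (closure Q))" for Q
  define ix where "ix Q = nat \<lfloor>log 2 (\<rho> Q)\<rfloor>" for Q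
  \<comment> \<open>The summand of the Carleson embedding for the measure \<sigma> dx with
    coefficients c Q = \<sigma>(Q).\<close>
  define y where "y Q = measure (weighted \<sigma>) Q * (av Q / measure (weighted \<sigma>) Q) powr p" for Q
  have q: "0 < q" "1 \<le> q / p" using p pq by auto
  have X0: "0 \<le> X" unfolding X_def by simp
  have b0: "0 \<le> b" unfolding b_def by simp
  have gm': "g \<in> borel_measurable (weighted \<sigma>)" using gm unfolding weighted_def by simp
  have Qs: "Q \<in> sets lebesgue" "emeasure lebesgue Q < \<infinity>" "0 < measure lebesgue Q" if "Q \<in> F" for Q
    using almost_cube_sets almost_cube_fin almost_cube_measure_pos F(3)[OF that] by blast+
  have sint: "set_integrable (weighted \<sigma>) Q g" if "Q \<in> F" for Q
    using that F(3) Qs emeasure_weighted_fin[OF _ \<sigma>]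
    by (intro set_integrable_of_powr[OF gm' g0 p gint]) auto
  have lint: "set_integrable lebesgue Q (\<lambda>x. \<sigma> x * g x)" if "Q \<in> F" for Q
  proof -
    have "(\<lambda>x. indicat_real Q x * g x) \<in> borel_measurable lebesgue"
      using gm Qs(1)[OF that] by simp
    then have "integrable lebesgue (\<lambda>x. \<sigma> x * (indicat_real Q x * g x))"
      using sint[OF that] integrable_weighted_iff[OF \<sigma>] unfolding set_integrable_def by simp
    then show ?thesis unfolding set_integrable_def by (simp add: mult.left_commute)
  qed
  have av_eq: "av Q = (LINT x:Q|lebesgue. \<sigma> x * g x)" if "Q \<in> F" for Q
    unfolding av_def using set_integral_weighted[OF \<sigma> gm Qs(1)[OF that]] .
  have av0: "0 \<le> av Q" for Q
    unfolding av_def set_lebesgue_integral_def using g0 by simp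
  have h0: "0 \<le> \<sigma> x * g x" for x using g0 weight_nonneg[OF \<sigma>] by simp
  have \<theta>: "0 \<le> \<alpha> / real CARD('n)" using \<alpha> by simp
  have FL: "F \<subseteq> sets lebesgue" using Qs by auto
  obtain S E where S: "S \<subseteq> F" and Spos: "\<And>P. P \<in> S \<Longrightarrow> 0 < a P"
    and cover: "\<And>Q x. Q \<in> F \<Longrightarrow> x \<in> Q \<Longrightarrow> 0 < a Q \<Longrightarrow> \<exists>P\<in>S. x \<in> P \<and> a Q \<le> 2 * a P"
    and E: "\<And>Q. Q \<in> S \<Longrightarrow> E Q \<in> sets lebesgue \<and> E Q \<subseteq> Q \<and> measure lebesgue Q \<le> 2 * measure lebesgue (E Q)"
    and overlap: "\<And>x. card {Q\<in>S. x \<in> E Q} \<le> 2"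
    using sparse_selection[OF F(1,2) FL Qs(2,3) lint h0 \<theta>] unfolding a_def by blast
  have fS: "finite S" using S F(1) finite_subset by blast
  \<comment> \<open>If \<sigma>(Q) = 0, then the integral of g \<sigma> over Q vanishes, against a Q
    > 0.\<close>
  have s_pos: "0 < measure (weighted \<sigma>) Q" if Q: "Q \<in> S" for Q
  proof (rule ccontr)
    assume "\<not> 0 < measure (weighted \<sigma>) Q"
    then have "measure (weighted \<sigma>) Q = 0" by (simp add: order_less_le)
    moreover have "emeasure (weighted \<sigma>) Q < \<infinity>" using emeasure_weighted_fin[OF F(3) \<sigma>] Q S by auto
    ultimately have "Q \<in> null_sets (weighted \<sigma>)"
      using Q S Qs by (auto simp: null_sets_def emeasure_eq_ennreal_measure)
    then have "AE x in weighted \<sigma>. x \<notin> Q" by (rule AE_not_in)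
    then have "AE x in weighted \<sigma>. indicat_real Q x *\<^sub>R g x = 0"
      by eventually_elim (simp add: indicator_def)
    then have "av Q = 0" unfolding av_def set_lebesgue_integral_def by (rule integral_eq_zero_AE)
    then have "a Q = 0" using av_eq Q S unfolding a_def by auto
    then show False using Spos[OF Q] by simp
  qed
  \<comment> \<open>Cubes with w(Q) = 0 add nothing to the sum, and there \<open>beta\<close> is 0
    by convention and says nothing about \<rho>.\<close>
  define S' where "S' = {Q\<in>S. 0 < measure (weighted w) Q}"
  have S': "S' \<subseteq> S" "finite S'" using fS unfolding S'_def by auto
  have rho: "rho \<sigma> (closure Q) < \<infinity>" "1 \<le> \<rho> Q"
      "measure (weighted \<sigma>) Q powr (1 / conj_exp p) * measure (weighted w) Q powr (1 / q)
        / measure lebesgue Q powr (1 - \<alpha> / real CARD('n)) * \<rho> Q powr (1 / p) * \<epsilon> (\<rho> Q) \<le> b"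
    if "Q \<in> S'" for Q
    using two_weight_bound[OF \<sigma> w F(3) fin pos, of Q] s_pos that S
    unfolding S'_def \<rho>_def b_def by auto
  have ix: "2 ^ ix Q \<le> \<rho> Q" "\<rho> Q \<le> 2 * 2 ^ ix Q" if "Q \<in> S'" for Q
  proof -
    have r1: "1 \<le> \<rho> Q" using rho that by blast
    then have l0: "0 \<le> log 2 (\<rho> Q)" by simp
    then have i: "real (ix Q) \<le> log 2 (\<rho> Q)" "log 2 (\<rho> Q) \<le> real (ix Q) + 1"
      unfolding ix_def by linarith+
    have "2 powr (real (ix Q)) \<le> \<rho> Q" using i(1) r1 le_log_iff[of 2 "\<rho> Q" "real (ix Q)"] by simp
    then show "2 ^ ix Q \<le> \<rho> Q" by (simp add: powr_realpow)
    have "\<rho> Q \<le> 2 powr (real (ix Q) + 1)" using i(2) r1 log_le_iff[of 2 "\<rho> Q" "real (ix Q) + 1"] by simp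
    then show "\<rho> Q \<le> 2 * 2 ^ ix Q" by (simp add: powr_realpow powr_add)
  qed
  have y0: "0 \<le> y Q" for Q unfolding y_def by simp
  have level: "(\<Sum>Q\<in>{Q\<in>S'. ix Q = r}. measure (weighted w) Q * a Q powr q)
      \<le> b powr q * (8 * carleson_const p) powr (q / p) * X powr (q / p) * \<epsilon> (2 ^ r) powr - q" for r
  proof -
    define T where "T = {Q\<in>S'. ix Q = r}"
    have T: "T \<subseteq> S'" "T \<subseteq> S" "T \<subseteq> F" "finite T" using S' S unfolding T_def by auto
    have term_le: "measure (weighted w) Q * a Q powr q
        \<le> b powr q * \<epsilon> (2 ^ r) powr - q * (y Q / 2 ^ r) powr (q / p)" if Q: "Q \<in> T" for Q
    proof -
      have QS: "Q \<in> S'" "Q \<in> S" "Q \<in> F" "ix Q = r" using Q T unfolding T_def by auto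
      have aQ: "a Q = av Q / measure lebesgue Q powr (1 - \<alpha> / real CARD('n))"
        unfolding a_def av_eq[OF QS(3)] ..
      have r1: "(1::real) \<le> 2 ^ r" by simp
      have "\<epsilon> (2 ^ r) \<le> \<epsilon> (\<rho> Q)"
      proof (rule mono_onD[OF mono])
        show "2 ^ r \<in> {1::real..}" "\<rho> Q \<in> {1..}" using r1 rho(2)[OF QS(1)] by (simp_all only: atLeast_iff)
        show "2 ^ r \<le> \<rho> Q" using ix(1)[OF QS(1)] QS(4) by simp
      qed
      then show ?thesis
        unfolding aQ y_def
        using bump_term_bound[OF p q(1) s_pos[OF QS(2)] _ _ _ av0 b0 _ _ rho(3)[OF QS(1)], of "\<epsilon> (2 ^ r)" r]
          QS(1) Qs(3)[OF QS(3)] pos r1 ix(1)[OF QS(1)] QS(4)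
        unfolding S'_def by simp
    qed
    \<comment> \<open>The packing constant 4 \<rho>(R) is at most 4 * 2 * 2^r because R belongs to
      class r.\<close>
    have carl: "(\<Sum>Q\<in>{Q\<in>T. Q \<subseteq> R}. measure (weighted \<sigma>) Q) \<le> 8 * 2 ^ r * measure (weighted \<sigma>) R"
      if R: "R \<in> T" for R
    proof -
      have RS: "R \<in> S'" "R \<in> S" "R \<in> F" "ix R = r" using R T unfolding T_def by auto
      have "(\<Sum>Q\<in>{Q\<in>T. Q \<subseteq> R}. measure (weighted \<sigma>) Q)
          \<le> 4 * enn2real (rho \<sigma> (closure R)) * measure (weighted \<sigma>) R"
      proof (rule sparse_packing[OF \<sigma>])
        show "finite {Q\<in>T. Q \<subseteq> R}" using T(4) by simp
        show "almost_cube R" using F(3) RS by blast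
        show "almost_cube Q \<and> Q \<subseteq> R" if "Q \<in> {Q\<in>T. Q \<subseteq> R}" for Q using that F(3) T by auto
        show "E Q \<in> sets lebesgue \<and> E Q \<subseteq> Q \<and> measure lebesgue Q \<le> 2 * measure lebesgue (E Q)"
          if "Q \<in> {Q\<in>T. Q \<subseteq> R}" for Q using that E T by auto
        show "card {Q\<in>{Q\<in>T. Q \<subseteq> R}. x \<in> E Q} \<le> 2" for x
        proof -
          have "card {Q\<in>{Q\<in>T. Q \<subseteq> R}. x \<in> E Q} \<le> card {Q\<in>S. x \<in> E Q}"
            using fS T by (intro card_mono) auto
          then show ?thesis using overlap[of x] by simp
        qed
        show "emeasure (weighted \<sigma>) R \<noteq> 0" using s_pos[OF RS(2)] unfolding measure_def by auto
        show "rho \<sigma> (closure R) < \<infinity>" by (rule rho(1)[OF RS(1)])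
      qed
      also have "\<dots> \<le> 4 * (2 * 2 ^ r) * measure (weighted \<sigma>) R"
        using ix(2)[OF RS(1)] RS(4) unfolding \<rho>_def by (intro mult_right_mono mult_left_mono) auto
      finally show ?thesis by simp
    qed
    have "(\<Sum>Q\<in>T. y Q) \<le> carleson_const p * (8 * 2 ^ r) * X"
      unfolding y_def av_def X_def
      using T F(3) Qs emeasure_weighted_fin[OF _ \<sigma>] s_pos carl
      by (intro carleson_embedding[OF T(4) laminar_subset[OF F(2) T(3)] _ _ _ _ _ _ p gm' g0 gint]) auto
    \<comment> \<open>The division by 2^r left over from the bump cancels the growth of the Carleson
      constant, so the bound no longer depends on r.\<close>
    then have ysum: "(\<Sum>Q\<in>T. y Q / 2 ^ r) \<le> 8 * carleson_const p * X"
      by (simp add: sum_divide_distrib[symmetric] field_simps)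
    have "(\<Sum>Q\<in>T. measure (weighted w) Q * a Q powr q)
        \<le> (\<Sum>Q\<in>T. b powr q * \<epsilon> (2 ^ r) powr - q * (y Q / 2 ^ r) powr (q / p))"
      by (intro sum_mono term_le)
    also have "\<dots> = b powr q * \<epsilon> (2 ^ r) powr - q * (\<Sum>Q\<in>T. (y Q / 2 ^ r) powr (q / p))"
      by (simp add: sum_distrib_left)
    also have "\<dots> \<le> b powr q * \<epsilon> (2 ^ r) powr - q * (\<Sum>Q\<in>T. y Q / 2 ^ r) powr (q / p)"
      using y0 q(2) T(4) by (intro mult_left_mono sum_powr_le_powr_sum) auto
    also have "\<dots> \<le> b powr q * \<epsilon> (2 ^ r) powr - q * (8 * carleson_const p * X) powr (q / p)"
      using ysum y0 q by (intro mult_left_mono powr_mono2) (auto intro!: sum_nonneg)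
    also have "\<dots> = b powr q * (8 * carleson_const p) powr (q / p) * X powr (q / p) * \<epsilon> (2 ^ r) powr - q"
      using X0 carleson_const_pos[OF p] by (simp add: powr_mult)
    finally show ?thesis unfolding T_def .
  qed
  have "(\<Sum>P\<in>S. measure (weighted w) P * a P powr q) = (\<Sum>P\<in>S'. measure (weighted w) P * a P powr q)"
    using fS unfolding S'_def by (intro sum.mono_neutral_right) (auto simp: order_less_le)
  also have "\<dots> = (\<Sum>r\<in>ix ` S'. \<Sum>P\<in>{P\<in>S'. ix P = r}. measure (weighted w) P * a P powr q)"
    using S' by (intro sum.group[symmetric]) auto
  also have "\<dots> \<le> (\<Sum>r\<in>ix ` S'. b powr q * (8 * carleson_const p) powr (q / p) * X powr (q / p) * \<epsilon> (2 ^ r) powr - q)"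
    by (intro sum_mono level)
  also have "\<dots> = b powr q * (8 * carleson_const p) powr (q / p) * X powr (q / p) * (\<Sum>r\<in>ix ` S'. \<epsilon> (2 ^ r) powr - q)"
    by (simp add: sum_distrib_left)
  also have "\<dots> \<le> b powr q * (8 * carleson_const p) powr (q / p) * X powr (q / p) * (\<epsilon> 1 powr - q + 2)"
    using S' by (intro mult_left_mono sum_dyadic_values_le[OF pos mono q(1) int]) auto
  finally have "(\<Sum>P\<in>S. measure (weighted w) P * a P powr q) \<le> bump_const p q \<epsilon> * b powr q * X powr (q / p)"
    unfolding bump_const_def by (simp add: mult_ac)
  then show ?thesis using that[OF S cover] unfolding b_def X_def by blast
qed

section \<open>Shifted dyadic grids\<close>

text \<open>The half-open cube of side L with lower corner v + L m, for L > 0. The floor form turns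
  nesting into integer division.\<close>

definition dyadic_cube :: "real^'n \<Rightarrow> real \<Rightarrow> ('n \<Rightarrow> int) \<Rightarrow> (real^'n) set" where
  "dyadic_cube v L m = {x. \<forall>i. \<lfloor>(x $ i - v $ i) / L\<rfloor> = m i}"

lemma mem_dyadic_cube:
  assumes "0 < L"
  shows "x \<in> dyadic_cube v L m \<longleftrightarrow> (\<forall>i. v $ i + L * m i \<le> x $ i \<and> x $ i < v $ i + L * m i + L)"
proof -
  have "\<lfloor>(x $ i - v $ i) / L\<rfloor> = m i \<longleftrightarrow> v $ i + L * m i \<le> x $ i \<and> x $ i < v $ i + L * m i + L" for i
    using assms by (simp add: floor_eq_iff field_simps)
  then show ?thesis unfolding dyadic_cube_def by simp
qed

text \<open>The cube lies between an open box and its closure, which differ by a null set. The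
  nested \<open>\<chi>\<close> in the upper corner keeps the shape required by
  \<open>cubes\<close>.\<close>

lemma dyadic_cube_facts:
  fixes v :: "real^'n"
  assumes L: "0 < L"
  shows closure_dyadic_cube: "closure (dyadic_cube v L m)
      = cbox (\<chi> i. v $ i + L * m i) (\<chi> i. (\<chi> i. v $ i + L * m i) $ i + L)"
    and almost_cube_dyadic: "almost_cube (dyadic_cube v L m)"
proof -
  let ?l = "\<chi> i. v $ i + L * m i" and ?D = "dyadic_cube v L m"
  let ?u = "\<chi> i. ?l $ i + L"
  have sub: "box ?l ?u \<subseteq> ?D" "?D \<subseteq> cbox ?l ?u"
    by (auto simp: mem_dyadic_cube[OF L] mem_box_cart less_eq_real_def)
  have "box ?l ?u \<noteq> {}" using L by (simp add: interval_ne_empty_cart)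
  then have clb: "closure (box ?l ?u) = cbox ?l ?u" by (rule closure_box)
  show cl: "closure ?D = cbox ?l ?u"
  proof
    show "closure ?D \<subseteq> cbox ?l ?u" by (rule closure_minimal[OF sub(2) closed_cbox])
    show "cbox ?l ?u \<subseteq> closure ?D" using closure_mono[OF sub(1)] clb by simp
  qed
  have neg: "negligible (cbox ?l ?u - box ?l ?u)" by (rule negligible_frontier_interval)
  have "?D - box ?l ?u \<in> sets lebesgue"
    using sub by (intro negligible_imp_sets negligible_subset[OF neg]) auto
  then have "box ?l ?u \<union> (?D - box ?l ?u) \<in> sets lebesgue" by (intro sets.Un) auto
  moreover have "box ?l ?u \<union> (?D - box ?l ?u) = ?D" using sub(1) by blast
  ultimately have "?D \<in> sets lebesgue" by simp
  moreover have "closure ?D - ?D \<in> null_sets lebesgue"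
    unfolding cl negligible_iff_null_sets[symmetric] using sub by (intro negligible_subset[OF neg]) auto
  moreover have "closure ?D \<in> cubes" unfolding cl cubes_def using L by blast
  ultimately show "almost_cube ?D" unfolding almost_cube_def by simp
qed

lemma measure_dyadic_cube:
  fixes v :: "real^'n"
  assumes L: "0 < L" shows "measure lebesgue (dyadic_cube v L m) = L ^ CARD('n)"
  unfolding measure_closure[OF almost_cube_dyadic[OF L], symmetric] closure_dyadic_cube[OF L]
  by (rule measure_cube) (use L in simp)

text \<open>The shift v is common to all scales, which keeps the cubes nested; N bounds the scales
  and K the positions, which keeps the family finite.\<close>

definition dyadic_grid :: "real^'n \<Rightarrow> real \<Rightarrow> nat \<Rightarrow> int \<Rightarrow> (real^'n) set set" where
  "dyadic_grid v h N K = {dyadic_cube v (h * 2 ^ k) m | k m. k \<le> N \<and> (\<forall>i. \<bar>m i\<bar> \<le> K)}"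

lemma finite_dyadic_grid: "finite (dyadic_grid (v :: real^'n) h N K)"
proof -
  have "finite (PiE (UNIV :: 'n set) (\<lambda>_. {-K..K}))" by (intro finite_PiE) auto
  then have "finite ({..N} \<times> PiE (UNIV :: 'n set) (\<lambda>_. {-K..K}))" by simp
  then have "finite ((\<lambda>(k, m). dyadic_cube v (h * 2 ^ k) m) ` ({..N} \<times> PiE (UNIV :: 'n set) (\<lambda>_. {-K..K})))"
    by (rule finite_imageI)
  moreover have "dyadic_grid v h N K
      \<subseteq> (\<lambda>(k, m). dyadic_cube v (h * 2 ^ k) m) ` ({..N} \<times> PiE (UNIV :: 'n set) (\<lambda>_. {-K..K}))"
  proof
    fix Q assume "Q \<in> dyadic_grid v h N K"
    then obtain k m where "Q = dyadic_cube v (h * 2 ^ k) m" "k \<le> N" "\<forall>i. \<bar>m i\<bar> \<le> K"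
      unfolding dyadic_grid_def by blast
    moreover from this have "m \<in> PiE UNIV (\<lambda>_. {-K..K})" by (auto simp: abs_le_iff minus_le_iff)
    ultimately show "Q \<in> (\<lambda>(k, m). dyadic_cube v (h * 2 ^ k) m) ` ({..N} \<times> PiE UNIV (\<lambda>_. {-K..K}))"
      by force
  qed
  ultimately show ?thesis by (rule rev_finite_subset)
qed

text \<open>The coarse index of a point is the integer quotient of its fine index by 2^(l-k), so it
  is constant on a fine cube; the common point x shows that its value is m'.\<close>

lemma dyadic_cube_nested:
  assumes "x \<in> dyadic_cube v (h * 2 ^ k) m" "x \<in> dyadic_cube v (h * 2 ^ l) m'" "k \<le> l"
  shows "dyadic_cube v (h * 2 ^ k) m \<subseteq> dyadic_cube v (h * 2 ^ l) m'"
proof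
  fix y assume y: "y \<in> dyadic_cube v (h * 2 ^ k) m"
  have coarse: "\<lfloor>(z $ i - v $ i) / (h * 2 ^ l)\<rfloor> = \<lfloor>(z $ i - v $ i) / (h * 2 ^ k)\<rfloor> div 2 ^ (l - k)" for z i
  proof -
    have "(2::real) ^ l = 2 ^ k * 2 ^ (l - k)" using assms(3) by (simp add: power_add[symmetric])
    then have "(z $ i - v $ i) / (h * 2 ^ l) = (z $ i - v $ i) / (h * 2 ^ k) / real_of_int (2 ^ (l - k))"
      by simp
    then show ?thesis by (simp only: floor_divide_real_eq_div zero_le_power zero_le_numeral)
  qed
  show "y \<in> dyadic_cube v (h * 2 ^ l) m'"
    using assms(1,2) y unfolding dyadic_cube_def by (simp add: coarse)
qed

lemma laminar_dyadic_grid: "laminar (dyadic_grid v h N K)"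
  unfolding laminar_def
proof (intro ballI)
  fix A B assume "A \<in> dyadic_grid v h N K" "B \<in> dyadic_grid v h N K"
  then obtain k m l m' where AB: "A = dyadic_cube v (h * 2 ^ k) m" "B = dyadic_cube v (h * 2 ^ l) m'"
    unfolding dyadic_grid_def by blast
  show "A \<inter> B = {} \<or> A \<subseteq> B \<or> B \<subseteq> A"
  proof (cases "A \<inter> B = {}")
    case False
    then obtain x where x: "x \<in> A" "x \<in> B" by blast
    have "k \<le> l \<or> l \<le> k" by linarith
    then show ?thesis
      using dyadic_cube_nested[of x v h k m l m'] dyadic_cube_nested[of x v h l m' k m] x
      unfolding AB by blast
  qed simp
qed

lemma almost_cube_dyadic_grid: "0 < h \<Longrightarrow> Q \<in> dyadic_grid v h N K \<Longrightarrow> almost_cube Q"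
  unfolding dyadic_grid_def by (auto intro!: almost_cube_dyadic)

text \<open>Endpoints of the two grids are at distance at least \<open>L / 3\<close>, since 3 does not divide a power of 2.\<close>

lemma one_third_trick:
  fixes a l L :: real
  assumes L: "0 < L" and l: "0 \<le> l" "3 * l < L"
  shows "\<lfloor>a / L\<rfloor> = \<lfloor>(a + l) / L\<rfloor> \<or> \<lfloor>(a - L * 2 ^ d / 3) / L\<rfloor> = \<lfloor>(a + l - L * 2 ^ d / 3) / L\<rfloor>"
proof (rule ccontr)
  assume "\<not> ?thesis"
  then have ne: "\<lfloor>a / L\<rfloor> \<noteq> \<lfloor>(a + l) / L\<rfloor>" "\<lfloor>(a - L * 2 ^ d / 3) / L\<rfloor> \<noteq> \<lfloor>(a + l - L * 2 ^ d / 3) / L\<rfloor>"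
    by auto
  have gap: "\<exists>m::int. z < m \<and> m \<le> z + l / L" if "\<lfloor>z\<rfloor> \<noteq> \<lfloor>z + l / L\<rfloor>" for z :: real
  proof -
    have "\<lfloor>z\<rfloor> \<le> \<lfloor>z + l / L\<rfloor>" using l L by (intro floor_mono) simp
    then have "\<lfloor>z\<rfloor> < \<lfloor>z + l / L\<rfloor>" using that by simp
    then show ?thesis by (intro exI[of _ "\<lfloor>z + l / L\<rfloor>"]) linarith
  qed
  have e: "(a + l) / L = a / L + l / L" "(a - L * 2 ^ d / 3) / L = a / L - 2 ^ d / 3"
    "(a + l - L * 2 ^ d / 3) / L = a / L - 2 ^ d / 3 + l / L"
    using L by (simp_all add: field_simps)
  obtain m m' :: int where m: "a / L < m" "m \<le> a / L + l / L"
    and m': "a / L - 2 ^ d / 3 < m'" "m' \<le> a / L - 2 ^ d / 3 + l / L"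
    using gap ne unfolding e by metis
  have "l / L < 1 / 3" using l L by (simp add: field_simps)
  moreover have "real_of_int (3 * (m - m')) = 3 * real_of_int m - 3 * real_of_int m'" by simp
  \<comment> \<open>Both m and m' + 2^d/3 lie in (a/L, a/L + l/L], an interval shorter than 1/3. So
    the integers 3(m - m') and 2^d differ by less than 1 and coincide.\<close>
  ultimately have "\<bar>real_of_int (3 * (m - m')) - 2 ^ d\<bar> < 1"
    using m m' by linarith
  then have "real_of_int \<bar>3 * (m - m') - 2 ^ d\<bar> < real_of_int 1" by simp
  then have "\<bar>3 * (m - m') - 2 ^ d\<bar> < (1::int)" by (simp only: of_int_less_iff)
  then have "3 * (m - m') = 2 ^ d" by linarith
  then have "(3::int) dvd 2 ^ d" by (metis dvd_triv_left)
  moreover have "coprime (3::int) (2 ^ d)"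
  proof -
    have "coprime (3::int) 2" using coprime_add_one_left[of "2::int"] by simp
    then show ?thesis by simp
  qed
  ultimately show False using coprime_absorb_left[of "3::int" "2 ^ d"] by simp
qed

text \<open>The shift is chosen separately in each coordinate, which gives one grid per set U.
  Taking T to be the coarsest side makes T/3 a multiple 2^d/3 of every side in use, so one shift
  serves all scales.\<close>

definition third_shift :: "real \<Rightarrow> 'n set \<Rightarrow> real^'n" where
  "third_shift T U = (\<chi> i. if i \<in> U then T / 3 else 0)"

text \<open>The least dyadic side L with 3 l < L also satisfies L <= 6 l, which gives the factor
  6^n. The hypotheses on l keep this side among the 2N + 1 scales from 2^(-N) to 2^N and above the
  smallest one.\<close>

lemma cube_subset_dyadic:
  fixes a :: "real^'n"
  assumes l: "0 < l" "1 \<le> 3 * l * 2 ^ N" "3 * l < 2 ^ N" and a: "\<And>i. \<bar>a $ i\<bar> \<le> 2 ^ N"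
  shows "\<exists>U. \<exists>P \<in> dyadic_grid (third_shift (2 ^ N) U) (1 / 2 ^ N) (2 * N) (4 * 4 ^ N).
    cbox a (\<chi> i. a $ i + l) \<subseteq> P \<and> measure lebesgue P \<le> 6 ^ CARD('n) * measure lebesgue (cbox a (\<chi> i. a $ i + l))"
proof -
  define k where "k = (LEAST k. 3 * l * 2 ^ N < 2 ^ k)"
  have top: "3 * l * 2 ^ N < 2 ^ (2 * N)"
    using l(3) by (simp add: power_add mult_2)
  have k1: "3 * l * 2 ^ N < 2 ^ k" unfolding k_def by (rule LeastI[of _ "2 * N"]) (rule top)
  have k2: "k \<le> 2 * N" unfolding k_def by (rule Least_le) (rule top)
  have "k \<noteq> 0" using k1 l(2) by (intro notI) simp
  then have "\<not> 3 * l * 2 ^ N < 2 ^ (k - 1)" unfolding k_def by (intro not_less_Least) simp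
  moreover have "(2::real) ^ k = 2 * 2 ^ (k - 1)" using \<open>k \<noteq> 0\<close> by (simp add: power_eq_if)
  ultimately have k3: "2 ^ k \<le> 6 * l * 2 ^ N" by simp
  define L :: real where "L = 1 / 2 ^ N * 2 ^ k"
  have L: "0 < L" "3 * l < L" "L \<le> 6 * l" "1 / 2 ^ N \<le> L"
    using k1 k3 unfolding L_def by (simp_all add: field_simps)
  have T: "2 ^ N = L * 2 ^ (2 * N - k)"
  proof -
    have "2 ^ k * 2 ^ (2 * N - k) = (2::real) ^ N * 2 ^ N"
      using k2 by (simp add: power_add[symmetric] mult_2)
    then show ?thesis unfolding L_def by simp
  qed
  \<comment> \<open>Exactly the coordinates in which the unshifted grid cuts the side of the cube;
    there the one-third trick supplies the shifted grid.\<close>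
  define U where "U = {i. \<lfloor>a $ i / L\<rfloor> \<noteq> \<lfloor>(a $ i + l) / L\<rfloor>}"
  define v :: "real^'n" where "v = third_shift (2 ^ N) U"
  define m where "m i = \<lfloor>(a $ i - v $ i) / L\<rfloor>" for i
  have v: "0 \<le> v $ i" "v $ i \<le> 2 ^ N" for i unfolding v_def third_shift_def by auto
  have ends: "\<lfloor>(a $ i + l - v $ i) / L\<rfloor> = m i" for i
    using one_third_trick[OF L(1) _ L(2), of "a $ i" "2 * N - k"] l(1)
    unfolding m_def v_def third_shift_def T[symmetric] U_def by (auto simp: algebra_simps)
  have sub: "cbox a (\<chi> i. a $ i + l) \<subseteq> dyadic_cube v L m"
  proof
    fix x assume x: "x \<in> cbox a (\<chi> i. a $ i + l)"
    have "\<lfloor>(x $ i - v $ i) / L\<rfloor> = m i" for i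
    proof (rule antisym)
      have x': "a $ i \<le> x $ i" "x $ i \<le> a $ i + l" using x by (auto simp: mem_box_cart)
      have "(x $ i - v $ i) / L \<le> (a $ i + l - v $ i) / L"
        using x' L(1) by (intro divide_right_mono) auto
      then show "\<lfloor>(x $ i - v $ i) / L\<rfloor> \<le> m i"
        unfolding ends[symmetric] by (rule floor_mono)
      have "(a $ i - v $ i) / L \<le> (x $ i - v $ i) / L"
        using x' L(1) by (intro divide_right_mono) auto
      then show "m i \<le> \<lfloor>(x $ i - v $ i) / L\<rfloor>"
        unfolding m_def by (rule floor_mono)
    qed
    then show "x \<in> dyadic_cube v L m" unfolding dyadic_cube_def by simp
  qed
  \<comment> \<open>Since |a - v| <= 2 * 2^N and L >= 2^(-N), the quotient is at most 2 * 4^N in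
    modulus; the slack covers the rounding of the floor.\<close>
  have mb: "\<bar>m i\<bar> \<le> 4 * 4 ^ N" for i
  proof -
    have p4: "(4::real) ^ N = 2 ^ N * 2 ^ N" by (simp add: power_mult_distrib[symmetric])
    have "\<bar>a $ i - v $ i\<bar> \<le> 2 * 2 ^ N" using a[of i] v[of i] by linarith
    also have "\<dots> \<le> 2 * 4 ^ N * L"
      using L(4) unfolding p4 by (simp add: field_simps)
    finally have "\<bar>(a $ i - v $ i) / L\<bar> \<le> 2 * 4 ^ N"
      using L(1) by (simp add: field_simps)
    moreover have "(1::real) \<le> 4 ^ N" by simp
    ultimately have "\<bar>real_of_int (m i)\<bar> \<le> 4 * 4 ^ N"
      unfolding m_def by linarith
    then have "real_of_int \<bar>m i\<bar> \<le> real_of_int (4 * 4 ^ N)" by simp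
    then show ?thesis by (simp only: of_int_le_iff)
  qed
  have "dyadic_cube v L m \<in> dyadic_grid v (1 / 2 ^ N) (2 * N) (4 * 4 ^ N)"
    unfolding dyadic_grid_def L_def using k2 mb by blast
  moreover have "measure lebesgue (dyadic_cube v L m)
      \<le> 6 ^ CARD('n) * measure lebesgue (cbox a (\<chi> i. a $ i + l))"
  proof -
    have "L ^ CARD('n) \<le> (6 * l) ^ CARD('n)" using L by (intro power_mono) auto
    then show ?thesis using measure_cube[of l a] l(1) measure_dyadic_cube[OF L(1), of v m]
      by (simp add: power_mult_distrib)
  qed
  ultimately show ?thesis using sub unfolding v_def by blast
qed

section \<open>Passage to all cubes\<close>

lemma ennpow_mono: "0 < a \<Longrightarrow> x \<le> y \<Longrightarrow> ennpow x a \<le> ennpow y a"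
  unfolding ennpow_def
  by (auto simp: top_unique less_top intro!: ennreal_leI powr_mono2 enn2real_mono)

lemma eventually_le_power_2: "eventually (\<lambda>N. c \<le> 2 ^ N) sequentially" for c :: real
  using eventually_ge_at_top[of "nat \<lceil>c\<rceil>"]
proof eventually_elim
  case (elim N)
  then have "c \<le> real N" by linarith
  also have "\<dots> \<le> 2 ^ N" by (rule less_imp_le[OF of_nat_less_two_power])
  finally show ?case .
qed

lemma eventually_cube_subset_dyadic:
  fixes Q :: "(real^'n) set"
  assumes "Q \<in> cubes"
  shows "eventually (\<lambda>N. \<exists>U. \<exists>P \<in> dyadic_grid (third_shift (2 ^ N) U) (1 / 2 ^ N) (2 * N) (4 * 4 ^ N).
    Q \<subseteq> P \<and> measure lebesgue P \<le> 6 ^ CARD('n) * measure lebesgue Q) sequentially"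
proof -
  obtain a :: "real^'n" and l :: real where Q: "Q = cbox a (\<chi> i. a $ i + l)" and l: "0 < l"
    using assms unfolding cubes_def by blast
  have "eventually (\<lambda>N. 1 / (3 * l) \<le> 2 ^ N \<and> 3 * l + 1 \<le> 2 ^ N \<and> norm a \<le> 2 ^ N) sequentially"
    by (intro eventually_conj eventually_le_power_2)
  then show ?thesis
  proof eventually_elim
    case (elim N)
    have "\<bar>a $ i\<bar> \<le> 2 ^ N" for i
      using elim component_le_norm_cart[of a i] by linarith
    moreover have "1 \<le> 3 * l * 2 ^ N" using elim l by (simp add: field_simps)
    ultimately show ?case unfolding Q using l elim by (intro cube_subset_dyadic) auto
  qed
qed

text \<open>In \<kappa> the factor 6^n to the power 1 - \<alpha>/n is the cost of enlarging a cube
  to a dyadic one, and the factor 2 that of passing to a selected cube; the 2^n grids appear as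
  \<open>CARD('n set)\<close>.\<close>

lemma frac_maximal_bound:
  fixes \<alpha> p q :: real and \<epsilon> :: "real \<Rightarrow> real" and \<sigma> w f :: "real^'n \<Rightarrow> real"
  defines "\<kappa> \<equiv> (2 * (6 ^ CARD('n)) powr (1 - \<alpha> / real CARD('n))) powr q"
  assumes \<alpha>: "0 < \<alpha>" "\<alpha> < real CARD('n)" and p: "1 < p" and pq: "p \<le> q"
    and pos: "\<forall>t\<ge>1. 0 < \<epsilon> t" and mono: "mono_on {1..} \<epsilon>"
    and int: "(\<integral>\<^sup>+t\<in>{1..}. ennreal (1 / (t * \<epsilon> t powr q)) \<partial>lborel) = 1"
    and \<sigma>: "weight \<sigma>" and w: "weight w" and fin: "two_weight \<alpha> p q \<epsilon> \<sigma> w < \<infinity>"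
    and fm: "f \<in> borel_measurable lebesgue"
    and fint: "integrable (weighted \<sigma>) (\<lambda>x. \<bar>f x\<bar> powr p)"
  shows "(\<integral>\<^sup>+x. ennpow (frac_maximal \<alpha> (\<lambda>x. f x * \<sigma> x) x) q \<partial>weighted w)
    \<le> ennreal (\<kappa> * (real CARD('n set) * (bump_const p q \<epsilon> * enn2real (two_weight \<alpha> p q \<epsilon> \<sigma> w) powr q
        * (LINT x|weighted \<sigma>. \<bar>f x\<bar> powr p) powr (q / p))))"
proof -
  \<comment> \<open>The exponent of |Q| in the denominator: 1 minus the \<theta> of
    \<open>sparse_selection\<close>. It is positive because \<alpha> < n.\<close>
  define \<theta> where "\<theta> = 1 - \<alpha> / real CARD('n)"
  define a where "a Q = (LINT x:Q|lebesgue. \<sigma> x * \<bar>f x\<bar>) / measure lebesgue Q powr \<theta>" for Q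
  define B where "B = bump_const p q \<epsilon> * enn2real (two_weight \<alpha> p q \<epsilon> \<sigma> w) powr q
      * (LINT x|weighted \<sigma>. \<bar>f x\<bar> powr p) powr (q / p)"
  define F :: "nat \<Rightarrow> 'n set \<Rightarrow> (real^'n) set set"
    where "F N U = dyadic_grid (third_shift (2 ^ N) U) (1 / 2 ^ N) (2 * N) (4 * 4 ^ N)" for N U
  have q: "0 < q" using p pq by simp
  have \<theta>: "0 < \<theta>" unfolding \<theta>_def using \<alpha> by simp
  have gm: "(\<lambda>x. \<bar>f x\<bar>) \<in> borel_measurable lebesgue" using fm by simp
  then have gm': "(\<lambda>x. \<bar>f x\<bar>) \<in> borel_measurable (weighted \<sigma>)" unfolding weighted_def by simp
  have a0: "0 \<le> a Q" for Q
    unfolding a_def set_lebesgue_integral_def using weight_nonneg[OF \<sigma>] by simp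
  have B0: "0 \<le> B"
    unfolding B_def bump_const_def using carleson_const_pos[OF p] by (intro mult_nonneg_nonneg) auto
  have \<kappa>0: "0 \<le> \<kappa>" unfolding \<kappa>_def by simp
  have Fac: "almost_cube Q" if "Q \<in> F N U" for N U Q
    using that unfolding F_def by (intro almost_cube_dyadic_grid) auto
  \<comment> \<open>A predicate for the conclusion of \<open>finite_dyadic_estimate\<close>, so that
    one S can be chosen for all N and U at once.\<close>
  define good where "good N U S \<longleftrightarrow> S \<subseteq> F N U
      \<and> (\<forall>Q\<in>F N U. \<forall>x\<in>Q. 0 < a Q \<longrightarrow> (\<exists>P\<in>S. x \<in> P \<and> a Q \<le> 2 * a P))
      \<and> (\<Sum>P\<in>S. measure (weighted w) P * a P powr q) \<le> B" for N U S
  have "\<exists>S. good N U S" for N U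
  proof -
    have F: "finite (F N U)" "laminar (F N U)"
      unfolding F_def by (rule finite_dyadic_grid, rule laminar_dyadic_grid)
    have a_eq: "(LINT x:Q|lebesgue. \<sigma> x * \<bar>f x\<bar>) / measure lebesgue Q powr (1 - \<alpha> / real CARD('n)) = a Q" for Q
      unfolding a_def \<theta>_def ..
    note est = finite_dyadic_estimate[OF \<alpha>(1) p pq pos mono int \<sigma> w fin gm abs_ge_zero fint F Fac,
        unfolded a_eq B_def[symmetric]]
    show ?thesis
    proof (rule est)
      fix S assume "S \<subseteq> F N U"
        and "\<And>Q x. Q \<in> F N U \<Longrightarrow> x \<in> Q \<Longrightarrow> 0 < a Q \<Longrightarrow> \<exists>P\<in>S. x \<in> P \<and> a Q \<le> 2 * a P"
        and "(\<Sum>P\<in>S. measure (weighted w) P * a P powr q) \<le> B"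
      then show ?thesis unfolding good_def by blast
    qed
  qed
  then obtain S where good: "\<And>N U. good N U (S N U)" by metis
  have S: "S N U \<subseteq> F N U" for N U using good[of N U] unfolding good_def by (rule conjunct1)
  have cover: "\<exists>P\<in>S N U. x \<in> P \<and> a Q \<le> 2 * a P" if "Q \<in> F N U" "x \<in> Q" "0 < a Q" for N U Q x
    using good[of N U] that unfolding good_def by blast
  have bound: "(\<Sum>P\<in>S N U. measure (weighted w) P * a P powr q) \<le> B" for N U
    using good[of N U] unfolding good_def by (elim conjE)
  have fS: "finite (S N U)" for N U
    by (rule finite_subset[OF S]) (simp add: F_def finite_dyadic_grid)
  have Sac: "almost_cube P" if "P \<in> S N U" for N U P using S Fac that by blast
  \<comment> \<open>The supremum over grids and selected cubes is replaced by a finite measurable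
    sum, whose integral is governed by the bound on each S N U.\<close>
  define G where "G N x = (\<Sum>U\<in>UNIV. \<Sum>P\<in>S N U. ennreal (a P powr q) * indicator P x)" for N x
  have Pm: "(\<lambda>x. ennreal (a P powr q) * indicator P x) \<in> borel_measurable (weighted w)"
    if "P \<in> S N U" for N U P
  proof -
    have [measurable]: "P \<in> sets (weighted w)" using almost_cube_sets[OF Sac[OF that]] by simp
    show ?thesis by measurable
  qed
  have Gm: "G N \<in> borel_measurable (weighted w)" for N
    unfolding G_def by (intro borel_measurable_sum Pm)
  have Gint: "(\<integral>\<^sup>+x. G N x \<partial>weighted w) \<le> ennreal (real CARD('n set) * B)" for N
  proof -
    have "(\<integral>\<^sup>+x. G N x \<partial>weighted w)
        = (\<Sum>U\<in>UNIV. \<Sum>P\<in>S N U. \<integral>\<^sup>+x. ennreal (a P powr q) * indicator P x \<partial>weighted w)"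
      unfolding G_def by (simp add: nn_integral_sum Pm borel_measurable_sum)
    also have "\<dots> \<le> (\<Sum>U\<in>(UNIV :: 'n set set). ennreal B)"
    proof (rule sum_mono)
      fix U :: "'n set"
      have "(\<integral>\<^sup>+x. ennreal (a P powr q) * indicator P x \<partial>weighted w)
          = ennreal (measure (weighted w) P * a P powr q)" if "P \<in> S N U" for P
      proof -
        have "P \<in> sets (weighted w)" using almost_cube_sets[OF Sac[OF that]] by simp
        moreover have "emeasure (weighted w) P = ennreal (measure (weighted w) P)"
          using emeasure_weighted_fin[OF Sac[OF that] w] by (simp add: emeasure_eq_ennreal_measure)
        ultimately show ?thesis
          by (subst nn_integral_cmult_indicator) (simp_all add: ennreal_mult mult.commute)
      qed
      then have "(\<Sum>P\<in>S N U. \<integral>\<^sup>+x. ennreal (a P powr q) * indicator P x \<partial>weighted w)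
          = ennreal (\<Sum>P\<in>S N U. measure (weighted w) P * a P powr q)"
        by (subst sum_ennreal[symmetric]) auto
      also have "\<dots> \<le> ennreal B" by (intro ennreal_leI bound)
      finally show "(\<Sum>P\<in>S N U. \<integral>\<^sup>+x. ennreal (a P powr q) * indicator P x \<partial>weighted w) \<le> ennreal B" .
    qed
    also have "\<dots> = ennreal (real CARD('n set) * B)"
      using B0 by (simp add: ennreal_mult ennreal_of_nat_eq_real_of_nat)
    finally show ?thesis .
  qed
  define \<Lambda> where "\<Lambda> x = liminf (\<lambda>N. ennreal \<kappa> * G N x)" for x
  \<comment> \<open>The extended-real average in \<open>frac_maximal\<close> is the real number a Q,
    since f in L^p(\<sigma>) makes f \<sigma> integrable over compact sets.\<close>
  have aterm: "indicator Q x / ennreal (measure lebesgue Q powr \<theta>)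
      * (\<integral>\<^sup>+y\<in>Q. ennreal \<bar>f y * \<sigma> y\<bar> \<partial>lebesgue) = indicator Q x * ennreal (a Q)"
    and lint: "set_integrable lebesgue Q (\<lambda>x. \<sigma> x * \<bar>f x\<bar>)" if Q: "compact Q" "0 < measure lebesgue Q" for Q x
  proof -
    have QL: "Q \<in> sets lebesgue" using Q by (simp add: compact_imp_closed)
    have "set_integrable (weighted \<sigma>) Q (\<lambda>x. \<bar>f x\<bar>)"
      using emeasure_weighted_compact[OF \<sigma> Q(1)] QL
      by (intro set_integrable_of_powr[OF gm' abs_ge_zero p fint]) auto
    moreover have "(\<lambda>x. indicat_real Q x * \<bar>f x\<bar>) \<in> borel_measurable lebesgue"
      using gm QL by simp
    ultimately have "integrable lebesgue (\<lambda>x. \<sigma> x * (indicat_real Q x * \<bar>f x\<bar>))"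
      using integrable_weighted_iff[OF \<sigma>] unfolding set_integrable_def by simp
    then show i: "set_integrable lebesgue Q (\<lambda>x. \<sigma> x * \<bar>f x\<bar>)"
      unfolding set_integrable_def by (simp add: mult.left_commute)
    have "(\<integral>\<^sup>+y\<in>Q. ennreal \<bar>f y * \<sigma> y\<bar> \<partial>lebesgue)
        = (\<integral>\<^sup>+y. ennreal (indicat_real Q y *\<^sub>R (\<sigma> y * \<bar>f y\<bar>)) \<partial>lebesgue)"
      using weight_nonneg[OF \<sigma>]
      by (intro nn_integral_cong) (auto simp: indicator_def abs_mult mult.commute)
    also have "\<dots> = ennreal (LINT x:Q|lebesgue. \<sigma> x * \<bar>f x\<bar>)"
      unfolding set_lebesgue_integral_def using i weight_nonneg[OF \<sigma>]
      by (intro nn_integral_eq_integral) (auto simp: set_integrable_def)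
    finally have "(\<integral>\<^sup>+y\<in>Q. ennreal \<bar>f y * \<sigma> y\<bar> \<partial>lebesgue) = ennreal (LINT x:Q|lebesgue. \<sigma> x * \<bar>f x\<bar>)" .
    moreover have "ennreal (LINT x:Q|lebesgue. \<sigma> x * \<bar>f x\<bar>) / ennreal (measure lebesgue Q powr \<theta>) = ennreal (a Q)"
      unfolding a_def using Q weight_nonneg[OF \<sigma>]
      by (intro divide_ennreal) (auto simp: set_lebesgue_integral_def)
    ultimately show "indicator Q x / ennreal (measure lebesgue Q powr \<theta>)
        * (\<integral>\<^sup>+y\<in>Q. ennreal \<bar>f y * \<sigma> y\<bar> \<partial>lebesgue) = indicator Q x * ennreal (a Q)"
      by (simp add: divide_ennreal_def mult_ac)
  qed
  \<comment> \<open>A fixed cube is covered by the truncated grids for all large N, though U may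
    vary with N; this suffices for a lower bound on the limit inferior.\<close>
  have small: "ennreal (a Q powr q) \<le> \<Lambda> x" if Q: "Q \<in> cubes" "x \<in> Q" for Q x
    unfolding \<Lambda>_def
  proof (rule Liminf_bounded)
    show "eventually (\<lambda>N. ennreal (a Q powr q) \<le> ennreal \<kappa> * G N x) sequentially"
      using eventually_cube_subset_dyadic[OF Q(1)]
    proof eventually_elim
      case (elim N)
      then obtain U P where P: "P \<in> F N U" "Q \<subseteq> P"
        and PQ: "measure lebesgue P \<le> 6 ^ CARD('n) * measure lebesgue Q"
        unfolding F_def by blast
      show ?case
      proof (cases "a Q = 0")
        case True
        then show ?thesis using q by simp
      next
        case False
        have mQ: "0 < measure lebesgue Q" by (rule cubes_measure_pos[OF Q(1)])
        have Pac: "almost_cube P" by (rule Fac[OF P(1)])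
        have mP: "0 < measure lebesgue P" by (rule almost_cube_measure_pos[OF Pac])
        have mcP: "0 < measure lebesgue (closure P)" using mP measure_closure[OF Pac] by simp
        have intP: "set_integrable lebesgue P (\<lambda>x. \<sigma> x * \<bar>f x\<bar>)"
          using closure_subset
          by (intro set_integrable_subset[OF lint[OF cubes_compact[OF closure_almost_cube[OF Pac]] mcP]]
              almost_cube_sets[OF Pac]) auto
        have intQ: "set_integrable lebesgue Q (\<lambda>x. \<sigma> x * \<bar>f x\<bar>)"
          by (rule lint[OF cubes_compact[OF Q(1)] mQ])
        have "(LINT x:Q|lebesgue. \<sigma> x * \<bar>f x\<bar>) \<le> (LINT x:P|lebesgue. \<sigma> x * \<bar>f x\<bar>)"
          unfolding set_lebesgue_integral_def
          using intP intQ P(2) weight_nonneg[OF \<sigma>]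
          by (intro integral_mono) (auto simp: set_integrable_def indicator_def)
        also have "\<dots> = a P * measure lebesgue P powr \<theta>"
          unfolding a_def using mP by simp
        also have "\<dots> \<le> a P * (6 ^ CARD('n) * measure lebesgue Q) powr \<theta>"
          using PQ a0 \<theta> by (intro mult_left_mono powr_mono2) auto
        also have "\<dots> = (6 ^ CARD('n)) powr \<theta> * a P * measure lebesgue Q powr \<theta>"
          by (simp add: powr_mult)
        finally have aQP: "a Q \<le> (6 ^ CARD('n)) powr \<theta> * a P"
          unfolding a_def[of Q] using mQ by (simp add: pos_divide_le_eq)
        have "0 < a P"
          using aQP False a0[of Q] a0[of P] by (cases "a P = 0") auto
        moreover have "x \<in> P" using P(2) Q(2) by blast
        ultimately obtain R where R: "R \<in> S N U" "x \<in> R" "a P \<le> 2 * a R"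
          using cover[OF P(1)] by blast
        note aQP
        also have "(6 ^ CARD('n)) powr \<theta> * a P \<le> (6 ^ CARD('n)) powr \<theta> * (2 * a R)"
          using R(3) by (rule mult_left_mono) simp
        also have "\<dots> = 2 * (6 ^ CARD('n)) powr \<theta> * a R" by simp
        finally have "a Q \<le> 2 * (6 ^ CARD('n)) powr \<theta> * a R" .
        then have "a Q powr q \<le> (2 * (6 ^ CARD('n)) powr \<theta> * a R) powr q"
          using a0 q by (intro powr_mono2) auto
        also have "\<dots> = \<kappa> * a R powr q"
          using a0[of R] unfolding \<kappa>_def \<theta>_def by (simp add: powr_mult)
        finally have "ennreal (a Q powr q) \<le> ennreal (\<kappa> * a R powr q)" by (rule ennreal_leI)
        also have "\<dots> = ennreal \<kappa> * (ennreal (a R powr q) * indicator R x)"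
          using R(2) \<kappa>0 by (simp add: ennreal_mult)
        also have "\<dots> \<le> ennreal \<kappa> * G N x"
        proof (rule mult_left_mono)
          have "ennreal (a R powr q) * indicator R x \<le> (\<Sum>P\<in>S N U. ennreal (a P powr q) * indicator P x)"
            using fS R(1) by (intro member_le_sum) auto
          also have "\<dots> \<le> G N x"
            unfolding G_def by (rule member_le_sum) auto
          finally show "ennreal (a R powr q) * indicator R x \<le> G N x" .
        qed simp
        finally show ?thesis .
      qed
    qed
  qed
  \<comment> \<open>\<open>small\<close> holds for each cube with the same bound \<Lambda> x, so
    taking q-th roots allows the supremum over all cubes through x.\<close>
  have ptw: "ennpow (frac_maximal \<alpha> (\<lambda>x. f x * \<sigma> x) x) q \<le> \<Lambda> x" for x
  proof (cases "\<Lambda> x = \<infinity>")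
    case False
    then obtain t where t: "\<Lambda> x = ennreal t" "0 \<le> t"
      by (metis ennreal_cases infinity_ennreal_def)
    have "frac_maximal \<alpha> (\<lambda>x. f x * \<sigma> x) x \<le> ennreal (t powr (1 / q))"
      unfolding frac_maximal_def
    proof (rule SUP_least)
      fix Q :: "(real^'n) set" assume Q: "Q \<in> cubes"
      have "a Q \<le> t powr (1 / q)" if "x \<in> Q"
      proof -
        have "a Q powr q \<le> t" using small[OF Q that] t by simp
        then have "(a Q powr q) powr (1 / q) \<le> t powr (1 / q)" using q by (intro powr_mono2) auto
        then show ?thesis using a0 q by (simp add: powr_powr)
      qed
      then have "indicator Q x * ennreal (a Q) \<le> ennreal (t powr (1 / q))"
        by (auto simp: indicator_def intro!: ennreal_leI)
      then show "indicator Q x / ennreal (measure lebesgue Q powr (1 - \<alpha> / real CARD('n)))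
          * (\<integral>\<^sup>+y\<in>Q. ennreal \<bar>f y * \<sigma> y\<bar> \<partial>lebesgue) \<le> ennreal (t powr (1 / q))"
        using aterm[OF cubes_compact[OF Q] cubes_measure_pos[OF Q]] unfolding \<theta>_def by simp
    qed
    then have "ennpow (frac_maximal \<alpha> (\<lambda>x. f x * \<sigma> x) x) q \<le> ennpow (ennreal (t powr (1 / q))) q"
      using q by (intro ennpow_mono)
    also have "\<dots> = ennreal t"
      using t q by (simp add: ennpow_ennreal powr_powr)
    finally show ?thesis using t by simp
  qed simp
  have "(\<integral>\<^sup>+x. ennpow (frac_maximal \<alpha> (\<lambda>x. f x * \<sigma> x) x) q \<partial>weighted w) \<le> (\<integral>\<^sup>+x. \<Lambda> x \<partial>weighted w)"
    by (intro nn_integral_mono ptw)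
  also have "\<dots> \<le> liminf (\<lambda>N. \<integral>\<^sup>+x. ennreal \<kappa> * G N x \<partial>weighted w)"
    unfolding \<Lambda>_def using Gm by (intro nn_integral_liminf) simp
  also have "\<dots> \<le> ennreal (\<kappa> * (real CARD('n set) * B))"
  proof (rule Liminf_le)
    have "(\<integral>\<^sup>+x. ennreal \<kappa> * G N x \<partial>weighted w) \<le> ennreal (\<kappa> * (real CARD('n set) * B))" for N
    proof -
      have "(\<integral>\<^sup>+x. ennreal \<kappa> * G N x \<partial>weighted w) = ennreal \<kappa> * (\<integral>\<^sup>+x. G N x \<partial>weighted w)"
        by (rule nn_integral_cmult[OF Gm])
      also have "\<dots> \<le> ennreal \<kappa> * ennreal (real CARD('n set) * B)"
        by (intro mult_left_mono Gint) simp
      finally show ?thesis using \<kappa>0 B0 by (simp add: ennreal_mult)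
    qed
    then show "eventually (\<lambda>N. (\<integral>\<^sup>+x. ennreal \<kappa> * G N x \<partial>weighted w)
        \<le> ennreal (\<kappa> * (real CARD('n set) * B))) sequentially" by simp
  qed simp
  finally show ?thesis unfolding B_def .
qed

text \<open>The q-th root of \<open>frac_maximal_bound\<close>, which is homogeneous in the
  two-weight constant and in f. Finiteness of \<open>two_weight\<close> expresses the convention
  that the inequality is trivial otherwise.\<close>

theorem theorem1p3:
  fixes \<alpha> p q :: real and \<epsilon> :: "real \<Rightarrow> real"
  assumes "0 < \<alpha>" and "\<alpha> < real CARD('n::finite)"
    and "1 < p" and "p \<le> q"
    and "\<forall>t\<ge>1. 0 < \<epsilon> t" and "mono_on {1..} \<epsilon>"
    and "(\<integral>\<^sup>+t\<in>{1..}. ennreal (1 / (t * \<epsilon> t powr q)) \<partial>lborel) = 1"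
  shows "\<exists>C::real. 0 < C \<and>
    (\<forall>(\<sigma> :: real^'n \<Rightarrow> real) (w :: real^'n \<Rightarrow> real).
      weight \<sigma> \<longrightarrow> weight w \<longrightarrow> two_weight \<alpha> p q \<epsilon> \<sigma> w < \<infinity> \<longrightarrow>
      (\<forall>f \<in> Lp_space p (weighted \<sigma>).
        Lp_norm q (weighted w) (frac_maximal \<alpha> (\<lambda>x. f x * \<sigma> x))
          \<le> ennreal C * two_weight \<alpha> p q \<epsilon> \<sigma> w * Lp_norm p (weighted \<sigma>) (\<lambda>x. ennreal \<bar>f x\<bar>)))"
proof -
  define D where "D = (2 * (6 ^ CARD('n)) powr (1 - \<alpha> / real CARD('n))) powr q
    * (real CARD('n set) * bump_const p q \<epsilon>)"
  have q: "0 < q" using assms by simp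
  have "0 < bump_const p q \<epsilon>"
    unfolding bump_const_def using carleson_const_pos[OF assms(3)]
    by (intro mult_pos_pos) (auto intro: add_nonneg_pos)
  then have D: "0 < D" unfolding D_def by (intro mult_pos_pos) auto
  show ?thesis
  proof (intro exI[of _ "D powr (1 / q)"] conjI allI impI ballI)
    show "0 < D powr (1 / q)" using D by simp
    fix \<sigma> w :: "real^'n \<Rightarrow> real" and f
    assume \<sigma>: "weight \<sigma>" and w: "weight w" and fin: "two_weight \<alpha> p q \<epsilon> \<sigma> w < \<infinity>"
      and f: "f \<in> Lp_space p (weighted \<sigma>)"
    define b where "b = enn2real (two_weight \<alpha> p q \<epsilon> \<sigma> w)"
    define X where "X = (LINT x|weighted \<sigma>. \<bar>f x\<bar> powr p)"
    have b: "two_weight \<alpha> p q \<epsilon> \<sigma> w = ennreal b" "0 \<le> b" unfolding b_def using fin by simp_all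
    have X0: "0 \<le> X" unfolding X_def by simp
    have fm': "f \<in> borel_measurable (weighted \<sigma>)" and
      fn: "Lp_norm p (weighted \<sigma>) (\<lambda>x. ennreal \<bar>f x\<bar>) < \<infinity>" using f unfolding Lp_space_def by auto
    have fm: "f \<in> borel_measurable lebesgue" using fm' unfolding weighted_def by simp
    have nn: "(\<integral>\<^sup>+x. ennpow (ennreal \<bar>f x\<bar>) p \<partial>weighted \<sigma>) = (\<integral>\<^sup>+x. ennreal (\<bar>f x\<bar> powr p) \<partial>weighted \<sigma>)"
      by (simp add: ennpow_ennreal)
    \<comment> \<open>\<open>ennpow\<close> sends \<infinity> to \<infinity>, so a finite norm
      forces a finite integral.\<close>
    have "(\<integral>\<^sup>+x. ennreal (\<bar>f x\<bar> powr p) \<partial>weighted \<sigma>) < \<infinity>"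
      using fn unfolding Lp_norm_def nn ennpow_def by (auto simp: less_top split: if_splits)
    then have fint: "integrable (weighted \<sigma>) (\<lambda>x. \<bar>f x\<bar> powr p)"
      using fm' by (intro integrableI_nonneg) auto
    then have "(\<integral>\<^sup>+x. ennreal (\<bar>f x\<bar> powr p) \<partial>weighted \<sigma>) = ennreal X"
      unfolding X_def by (intro nn_integral_eq_integral) auto
    then have rhs: "Lp_norm p (weighted \<sigma>) (\<lambda>x. ennreal \<bar>f x\<bar>) = ennreal (X powr (1 / p))"
      unfolding Lp_norm_def nn using X0 by (simp add: ennpow_ennreal)
    have "(\<integral>\<^sup>+x. ennpow (frac_maximal \<alpha> (\<lambda>x. f x * \<sigma> x) x) q \<partial>weighted w)
        \<le> ennreal (D * (b powr q * X powr (q / p)))"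
      using frac_maximal_bound[OF assms(1-7) \<sigma> w fin fm fint]
      unfolding D_def b_def X_def by (simp add: mult_ac)
    then have "Lp_norm q (weighted w) (frac_maximal \<alpha> (\<lambda>x. f x * \<sigma> x))
        \<le> ennpow (ennreal (D * (b powr q * X powr (q / p)))) (1 / q)"
      unfolding Lp_norm_def using q by (intro ennpow_mono) auto
    also have "\<dots> = ennreal ((D * (b powr q * X powr (q / p))) powr (1 / q))"
      using D by (intro ennpow_ennreal) auto
    also have "(D * (b powr q * X powr (q / p))) powr (1 / q) = D powr (1 / q) * b * X powr (1 / p)"
      using D b(2) q X0 by (simp add: powr_mult powr_powr)
    also have "ennreal \<dots> = ennreal (D powr (1 / q)) * two_weight \<alpha> p q \<epsilon> \<sigma> w
        * Lp_norm p (weighted \<sigma>) (\<lambda>x. ennreal \<bar>f x\<bar>)"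
      unfolding rhs b(1) using b(2) by (simp add: ennreal_mult)
    finally show "Lp_norm q (weighted w) (frac_maximal \<alpha> (\<lambda>x. f x * \<sigma> x))
        \<le> ennreal (D powr (1 / q)) * two_weight \<alpha> p q \<epsilon> \<sigma> w
          * Lp_norm p (weighted \<sigma>) (\<lambda>x. ennreal \<bar>f x\<bar>)" .
  qed
qed

end
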